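(* Let $\theta\in(0,1)$ and $m\in\mathbb{N}_+$ with $\theta^2=1/m$, and let $T_\theta:[0,\theta]\to[0,\theta]$ be $T_\theta(x)=\frac1x-\theta\left\lfloor\frac{1}{x\theta}\right\rfloor$ for $x\in(0,\theta]$, $T_\theta(0)=0$. (i) Let $\mu$ be a probability measure on $([0,\theta],\mathcal{B}_{[0,\theta]})$ which is non-atomic and has a Riemann-integrable density (with respect to Lebesgue measure). Then $$\lim_{n\to\infty}\mu\big(T_\theta^n<x\big)=\frac{1}{\log(1+\theta^2)}\log\big((m\theta+x)\theta\big),\qquad x\in[0,\theta].$$ (ii) If, in addition, the density of $\mu$ (i.e. the derivative of $x\mapsto\mu([0,x])$) is Lipschitz continuous, then there exist constants $0<q<1$ and $K>0$ such that for all $x\in[0,\theta]$ and $n\in\mathbb{N}_+$, $$\mu\big(T_\theta^n<x\big)=\frac{1+\alpha q^n}{\log(1+\theta^2)}\log\big((m\theta+x)\theta\big),$$ where $\alpha=\alpha(\mu,n,x)$ satisfies $|\alpha|\le K$. Consequently the $n$-th error term $e_n(\theta,\mu;x):=\mu(T_\theta^n<x)-\frac{1}{\log(1+\theta^2)}\log((m\theta+x)\theta)$ equals $\frac{\alpha q^n}{\log(1+\theta^2)}\log((m\theta+x)\theta)$.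
   Context: $\mu(T_\theta^n<x)$ denotes $\mu(\{y\in[0,\theta]:T_\theta^n(y)<x\})$. $\mathcal{B}_{[0,\theta]}$ is the Borel $\sigma$-algebra of $[0,\theta]$. *)

theory Defs
  imports "HOL-Probability.Probability"
begin

definition theta_map :: "real \<Rightarrow> real \<Rightarrow> real" where
  "theta_map \<theta> x = (if x = 0 then 0 else 1 / x - \<theta> * of_int \<lfloor>1 / (x * \<theta>)\<rfloor>)"

lemma theta_map_maps_to:
  assumes "0 < \<theta>" "x \<in> {0..\<theta>}"
  shows "theta_map \<theta> x \<in> {0..\<theta>}"
proof (cases "x = 0")
  case True
  then show ?thesis using assms by (simp add: theta_map_def)
next
  case False
  have "theta_map \<theta> x = \<theta> * frac (1 / (x * \<theta>))"
    using False assms by (simp add: theta_map_def frac_def field_simps)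
  moreover have "0 \<le> frac (1 / (x * \<theta>))" "frac (1 / (x * \<theta>)) \<le> 1"
    by (simp_all add: frac_lt_1 less_imp_le)
  ultimately show ?thesis
    using assms by (simp add: mult_left_le)
qed

text \<open>Riemann integrability: the mesh is bounded uniformly.
  (\<open>integrable_on\<close> is the gauge integral and would be strictly weaker.)\<close>

definition riemann_integrable :: "(real \<Rightarrow> real) \<Rightarrow> real \<Rightarrow> real \<Rightarrow> bool" where
  "riemann_integrable f a b \<longleftrightarrow>
     (\<exists>I. \<forall>\<epsilon>>0. \<exists>\<delta>>0. \<forall>p. p tagged_division_of {a..b} \<and> (\<forall>(t, J)\<in>p. measure lborel J < \<delta>)
        \<longrightarrow> \<bar>(\<Sum>(t, J)\<in>p. measure lborel J * f t) - I\<bar> < \<epsilon>)"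

definition nonatomic :: "'a measure \<Rightarrow> bool" where
  "nonatomic M \<longleftrightarrow>
     (\<forall>A\<in>sets M. 0 < emeasure M A \<longrightarrow>
        (\<exists>B\<in>sets M. B \<subseteq> A \<and> 0 < emeasure M B \<and> emeasure M B < emeasure M A))"

text \<open>The integral is over the completed measure \<open>lebesgue\<close> because a Riemann-integrable
  function is Lebesgue measurable but need not be Borel measurable.\<close>

definition lebesgue_density :: "real measure \<Rightarrow> (real \<Rightarrow> real) \<Rightarrow> bool" where
  "lebesgue_density M h \<longleftrightarrow>
     h \<in> borel_measurable (lebesgue_on (space M)) \<and> (\<forall>x\<in>space M. 0 \<le> h x) \<and>
     (\<forall>A\<in>sets M. emeasure M A = (\<integral>\<^sup>+ x\<in>A. ennreal (h x) \<partial>lebesgue))"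

definition lipschitz_derivative_on :: "real set \<Rightarrow> (real \<Rightarrow> real) \<Rightarrow> bool" where
  "lipschitz_derivative_on S F \<longleftrightarrow>
     (\<exists>f L. (\<forall>x\<in>S. (F has_real_derivative f x) (at x within S)) \<and> L-lipschitz_on S f)"

definition iterate_dist :: "real \<Rightarrow> real measure \<Rightarrow> nat \<Rightarrow> real \<Rightarrow> real" where
  "iterate_dist \<theta> \<mu> n x = measure \<mu> {y \<in> {0..\<theta>}. (theta_map \<theta> ^^ n) y < x}"

definition error_term :: "real \<Rightarrow> nat \<Rightarrow> real measure \<Rightarrow> nat \<Rightarrow> real \<Rightarrow> real" where
  "error_term \<theta> m \<mu> n x =
     iterate_dist \<theta> \<mu> n x - 1 / ln (1 + \<theta>\<^sup>2) * ln ((real m * \<theta> + x) * \<theta>)"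

end

theory Submission
  imports Defs "HOL-Real_Asymp.Real_Asymp"
begin

text \<open>
  Relative to the invariant density \<open>w x = 1 / (m \<theta> + x)\<close> the transfer operator of the map
  is the averaging operator \<open>U \<phi> x = \<Sum>j. p j x * \<phi> (1 / ((m + j) \<theta> + x))\<close> whose weights
  \<open>p j x\<close> telescope and sum to \<open>1\<close>. Summation by parts shows that \<open>U\<close> shrinks Lipschitz
  constants by the factor \<open>1 / m + 1 / (m + 1) \<le> 5 / 6\<close>, because \<open>\<theta> < 1\<close> forces \<open>m \<ge> 2\<close>. As \<open>U\<close>
  preserves the integral against \<open>w\<close>, the iterates \<open>U ^ n \<phi>\<close> converge uniformly and geometrically
  to the \<open>w\<close>-mean of \<open>\<phi>\<close>. Integrating over \<open>{0..<x}\<close> against \<open>w\<close> turns this into an error bound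
  relative to the limit law when the density is Lipschitz. An integrable density is
  approximated by Lipschitz functions in \<open>L\<^sup>1\<close>, which costs the rate but not the limit.
\<close>

section \<open>The contraction on Lipschitz functions\<close>

locale theta_expansion =
  fixes \<theta> :: real and m :: nat
  assumes theta_pos: "0 < \<theta>" and theta_less_one: "\<theta> < 1"
    and theta_square: "\<theta>\<^sup>2 = 1 / real m"
begin

text \<open>The index is shifted by \<open>m\<close> because the digit
  \<open>\<lfloor>1 / (x * \<theta>)\<rfloor>\<close> of a point of \<open>{0<..\<theta>}\<close> is
  at least \<open>1 / \<theta>\<^sup>2\<close>, that is, \<open>m\<close>.\<close>

definition denom :: "nat \<Rightarrow> real \<Rightarrow> real" where
  "denom j x = (real m + real j) * \<theta> + x"

definition branch :: "nat \<Rightarrow> real \<Rightarrow> real" where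
  "branch j x = 1 / denom j x"

text \<open>The total weight of the first \<open>j\<close> branches.\<close>

definition head :: "nat \<Rightarrow> real \<Rightarrow> real" where
  "head j x = real j * \<theta> / denom j x"

text \<open>An increment of \<open>head\<close>, so that the weights telescope and summation by
  parts applies directly; the closed product form is \<open>weight_eq\<close>.\<close>

definition weight :: "nat \<Rightarrow> real \<Rightarrow> real" where
  "weight j x = head (Suc j) x - head j x"

text \<open>The Gauss-type density without its normalising constant; its total mass over
  \<open>{0..\<theta>}\<close> is \<open>ln (1 + \<theta>\<^sup>2)\<close>.\<close>

definition invariant_density :: "real \<Rightarrow> real" where
  "invariant_density x = 1 / (real m * \<theta> + x)"

definition transfer :: "(real \<Rightarrow> real) \<Rightarrow> real \<Rightarrow> real" where
  "transfer \<phi> x = (\<Sum>j. weight j x * \<phi> (branch j x))"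

text \<open>The square of \<open>\<theta>\<close> lies strictly between 0 and 1. This excludes
  \<open>m = 1\<close>, and also \<open>m = 0\<close>, where \<open>1 / real m\<close> is 0 by the
  convention for division by zero.\<close>

lemma m_ge_two: "2 \<le> m"
proof (rule ccontr)
  assume "\<not> 2 \<le> m"
  then have "m = 0 \<or> m = 1" by auto
  moreover have "0 < \<theta>\<^sup>2" "\<theta>\<^sup>2 < 1"
    using theta_pos theta_less_one by (auto simp: power_less_one_iff)
  ultimately show False using theta_square by auto
qed

lemma m_theta_theta: "real m * (\<theta> * \<theta>) = 1"
  using theta_square m_ge_two by (simp add: power2_eq_square)

lemma m_theta: "real m * \<theta> = 1 / \<theta>"
  using m_theta_theta theta_pos by (simp add: field_simps)

section \<open>Denominators, inverse branches and their weights\<close>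

lemma denom_ge:
  assumes "0 \<le> x"
  shows "(real m + real j) * \<theta> \<le> denom j x"
  using assms by (simp add: denom_def)

lemma denom_ge_inverse:
  assumes "0 \<le> x"
  shows "1 / \<theta> \<le> denom j x"
  using denom_ge[OF assms, of j] m_theta theta_pos
  by (smt (verit) distrib_right mult_nonneg_nonneg of_nat_0_le_iff)

lemma denom_pos:
  assumes "0 \<le> x"
  shows "0 < denom j x"
  using denom_ge_inverse[OF assms, of j] theta_pos by (smt (verit) zero_less_divide_1_iff)

lemma denom_Suc: "denom (Suc j) x = denom j x + \<theta>"
  by (simp add: denom_def algebra_simps)

lemma branch_mem:
  assumes "0 \<le> x"
  shows "branch j x \<in> {0<..\<theta>}"
proof -
  have "1 / denom j x \<le> 1 / (1 / \<theta>)"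
    using denom_ge_inverse[OF assms, of j] theta_pos by (intro divide_left_mono) (auto simp: denom_pos assms)
  then show ?thesis using denom_pos[OF assms, of j] by (simp add: branch_def)
qed

text \<open>After cross-multiplication all terms with \<open>j\<close> cancel in the numerator. The
  remaining product makes it visible that the weights are nonnegative.\<close>

lemma weight_eq:
  assumes "0 \<le> x"
  shows "weight j x = \<theta> * (real m * \<theta> + x) / (denom j x * denom (Suc j) x)"
proof -
  have *: "denom j x \<noteq> 0" "denom (Suc j) x \<noteq> 0"
    using denom_pos[OF assms] by (simp_all add: less_imp_neq[THEN not_sym])
  have "(real j + 1) * \<theta> * denom j x - real j * \<theta> * denom (Suc j) x = \<theta> * (real m * \<theta> + x)"
    by (simp add: denom_def algebra_simps)
  then show ?thesis
    using * unfolding weight_def head_def by (simp add: diff_frac_eq mult.commute add.commute)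
qed

lemma weight_nonneg:
  assumes "0 \<le> x"
  shows "0 \<le> weight j x"
  using denom_pos[OF assms] assms theta_pos by (simp add: weight_eq less_imp_le)

lemma head_tendsto_one:
  assumes "0 \<le> x"
  shows "(\<lambda>j. head j x) \<longlonglongrightarrow> 1"
  unfolding head_def denom_def using theta_pos assms by real_asymp

lemma weight_sums_one:
  assumes "0 \<le> x"
  shows "(\<lambda>j. weight j x) sums 1"
  using telescope_sums[OF head_tendsto_one[OF assms]] by (simp add: weight_def head_def)

lemma sum_weight_le_one:
  assumes "0 \<le> x"
  shows "(\<Sum>j<n. weight j x) \<le> 1"
  using sum_le_suminf[of "\<lambda>j. weight j x" "{..<n}"] weight_sums_one[OF assms] weight_nonneg[OF assms]
  by (simp add: sums_iff)

text \<open>The factor \<open>(branch j x)\<^sup>2\<close> is the absolute derivative of the branch,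
  so this is the Jacobian identity behind the change of variables: \<open>transfer\<close> is the
  Perron-Frobenius operator conjugated by the invariant density.\<close>

lemma weight_invariant_density:
  assumes "0 \<le> x"
  shows "weight j x * invariant_density x = (branch j x)\<^sup>2 * invariant_density (branch j x)"
proof -
  have d: "0 < denom j x" "0 < denom (Suc j) x" "0 < real m * \<theta> + x"
    using denom_pos[OF assms] denom_pos[OF assms, of 0] by (auto simp: denom_def[of 0])
  \<comment> \<open>The relation between \<open>\<theta>\<close> and \<open>m\<close> enters here:
    with \<open>real m * \<theta>\<close> equal to \<open>1 / \<theta>\<close>, the common numerator
    is \<open>denom j x + \<theta>\<close>, the next denominator.\<close>
  have "real m * \<theta> + 1 / denom j x = denom (Suc j) x / (\<theta> * denom j x)"
    using d theta_pos by (simp add: m_theta denom_Suc add_divide_distrib)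
  then have "invariant_density (branch j x) = \<theta> * denom j x / denom (Suc j) x"
    by (simp add: invariant_density_def branch_def)
  moreover have "weight j x * invariant_density x = \<theta> / (denom j x * denom (Suc j) x)"
    using d by (simp add: weight_eq assms invariant_density_def)
  ultimately show ?thesis
    using d by (simp add: branch_def power2_eq_square)
qed

lemma summable_transfer:
  assumes "\<And>y. y \<in> {0..\<theta>} \<Longrightarrow> \<bar>\<phi> y\<bar> \<le> B" and "0 \<le> x"
  shows "summable (\<lambda>j. norm (weight j x * \<phi> (branch j x)))"
proof (rule summable_comparison_test)
  show "summable (\<lambda>j. weight j x * B)"
    using weight_sums_one[OF assms(2)] by (intro summable_mult2) (simp add: sums_iff)
  show "\<exists>N. \<forall>j\<ge>N. norm (norm (weight j x * \<phi> (branch j x))) \<le> weight j x * B"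
    using weight_nonneg[OF assms(2)] assms(1) branch_mem[OF assms(2)]
    by (intro exI[of _ 0]) (auto simp: abs_mult less_imp_le intro!: mult_left_mono)
qed

lemma lipschitz_bounded:
  assumes "L-lipschitz_on {0..\<theta>} \<phi>" and "x \<in> {0..\<theta>}"
  shows "\<bar>\<phi> x\<bar> \<le> \<bar>\<phi> 0\<bar> + L * \<theta>"
proof -
  have "\<bar>\<phi> x - \<phi> 0\<bar> \<le> L * \<bar>x - 0\<bar>"
    using lipschitz_onD[OF assms(1), of x 0] assms(2) theta_pos by (simp add: dist_real_def)
  also have "\<dots> \<le> L * \<theta>"
    using assms lipschitz_on_nonneg[OF assms(1)] by (intro mult_left_mono) auto
  finally show ?thesis by linarith
qed

section \<open>Variation of heads and branches\<close>

lemma inverse_denom_diff: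
  assumes "0 \<le> x" "0 \<le> y"
  shows "\<bar>1 / denom j x - 1 / denom j y\<bar> \<le> \<bar>x - y\<bar> / ((real m + real j) * \<theta>)\<^sup>2"
proof -
  have p: "0 < denom j x" "0 < denom j y"
    using denom_pos assms by auto
  have "1 / denom j x - 1 / denom j y = (y - x) / (denom j x * denom j y)"
    using p by (simp add: divide_simps) (simp add: denom_def)
  then have "\<bar>1 / denom j x - 1 / denom j y\<bar> = \<bar>x - y\<bar> / (denom j x * denom j y)"
    using p by (simp add: abs_mult)
  also have "\<dots> \<le> \<bar>x - y\<bar> / ((real m + real j) * \<theta> * ((real m + real j) * \<theta>))"
    using p denom_ge assms theta_pos m_ge_two
    by (intro divide_left_mono mult_mono mult_pos_pos) auto
  finally show ?thesis by (simp add: power2_eq_square)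
qed

lemma head_diff:
  assumes "0 \<le> x" "0 \<le> y"
  shows "\<bar>head j x - head j y\<bar> \<le> real j * \<bar>x - y\<bar> / ((real m + real j)\<^sup>2 * \<theta>)"
proof -
  have "head j x - head j y = real j * \<theta> * (1 / denom j x - 1 / denom j y)"
    by (simp add: head_def right_diff_distrib)
  then have "\<bar>head j x - head j y\<bar> = real j * \<theta> * \<bar>1 / denom j x - 1 / denom j y\<bar>"
    using theta_pos by (simp add: abs_mult)
  also have "\<dots> \<le> real j * \<theta> * (\<bar>x - y\<bar> / ((real m + real j) * \<theta>)\<^sup>2)"
    using inverse_denom_diff[OF assms] theta_pos by (intro mult_left_mono) auto
  also have "\<dots> = real j * \<bar>x - y\<bar> / ((real m + real j)\<^sup>2 * \<theta>)"
    using theta_pos by (simp add: power_mult_distrib power2_eq_square)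
  finally show ?thesis .
qed

text \<open>The branch \<open>j = 0\<close> contracts least, and there the squared denominator bound
  \<open>(real m * \<theta>)\<^sup>2\<close> is exactly \<open>m\<close>.\<close>

lemma branch_diff:
  assumes "0 \<le> x" "0 \<le> y"
  shows "\<bar>branch j x - branch j y\<bar> \<le> \<bar>x - y\<bar> / real m"
proof -
  have "\<bar>branch j x - branch j y\<bar> \<le> \<bar>x - y\<bar> / ((real m + real j) * \<theta>)\<^sup>2"
    using inverse_denom_diff[OF assms] by (simp add: branch_def)
  also have "\<dots> \<le> \<bar>x - y\<bar> / (real m * \<theta>)\<^sup>2"
    using theta_pos m_ge_two by (intro divide_left_mono power_mono mult_right_mono) auto
  also have "(real m * \<theta>)\<^sup>2 = real m"
    using m_theta_theta by (simp add: power2_eq_square algebra_simps)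
  finally show ?thesis .
qed

text \<open>The bound contains the reciprocal of two consecutive integers, \<open>m + j\<close> and
  \<open>m + j + 1\<close>, which later splits into a telescoping difference.\<close>

lemma branch_Suc_diff:
  assumes "0 \<le> x"
  shows "\<bar>branch (Suc j) x - branch j x\<bar> \<le> 1 / ((real m + real j) * (real m + real j + 1) * \<theta>)"
proof -
  have p: "0 < denom j x" "0 < denom (Suc j) x"
    using denom_pos assms by auto
  have "branch (Suc j) x - branch j x = - (\<theta> / (denom j x * denom (Suc j) x))"
    using p unfolding branch_def by (simp add: divide_simps) (simp add: denom_Suc)
  then have "\<bar>branch (Suc j) x - branch j x\<bar> = \<theta> / (denom j x * denom (Suc j) x)"
    using p theta_pos by simp
  also have "\<dots> \<le> \<theta> / ((real m + real j) * \<theta> * ((real m + real (Suc j)) * \<theta>))"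
    using p denom_ge[OF assms, of j] denom_ge[OF assms, of "Suc j"] theta_pos m_ge_two
    by (intro divide_left_mono mult_mono mult_pos_pos) auto
  also have "\<dots> = 1 / ((real m + real j) * (real m + real j + 1) * \<theta>)"
    using theta_pos by (simp add: mult_ac add_ac)
  finally show ?thesis .
qed

text \<open>Bounds one term of the summation by parts in \<open>lipschitz_transfer\<close>. The
  bound has the form of a telescoping difference, so that its sum over all \<open>j\<close> is at
  most \<open>L * \<bar>x - y\<bar> / (real m + 1)\<close>.\<close>

lemma summation_by_parts_step:
  assumes "L-lipschitz_on {0..\<theta>} \<phi>" and "0 \<le> x" "0 \<le> y"
  shows "\<bar>(head (Suc j) x - head (Suc j) y) * (\<phi> (branch (Suc j) y) - \<phi> (branch j y))\<bar>
    \<le> L * \<bar>x - y\<bar> * (real m / (real m + 1)) * (1 / (real m + real j) - 1 / (real m + real (Suc j)))"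
proof -
  define a where "a = real m + real j"
  have a: "a \<ge> m" "a > 0" using m_ge_two by (auto simp: a_def)
  have L: "0 \<le> L" by (rule lipschitz_on_nonneg[OF assms(1)])
  have "\<bar>head (Suc j) x - head (Suc j) y\<bar> \<le> real (Suc j) * \<bar>x - y\<bar> / ((a + 1)\<^sup>2 * \<theta>)"
    using head_diff[OF assms(2,3), of "Suc j"] by (simp add: a_def add_ac)
  \<comment> \<open>Replacing \<open>Suc j\<close> by the larger \<open>a + 1\<close> cancels one
    power; what remains decreases in \<open>j\<close>, so \<open>j = 0\<close> gives a uniform
    bound.\<close>
  also have "\<dots> \<le> (a + 1) * \<bar>x - y\<bar> / ((a + 1)\<^sup>2 * \<theta>)"
    using theta_pos a by (intro divide_right_mono mult_right_mono) (auto simp: a_def)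
  also have "\<dots> = \<bar>x - y\<bar> / ((a + 1) * \<theta>)"
    using theta_pos a by (simp add: power2_eq_square)
  also have "\<dots> \<le> \<bar>x - y\<bar> / ((m + 1) * \<theta>)"
    using theta_pos a by (intro divide_left_mono mult_right_mono mult_pos_pos) auto
  finally have 1: "\<bar>head (Suc j) x - head (Suc j) y\<bar> \<le> \<bar>x - y\<bar> / ((m + 1) * \<theta>)" .
  have "\<bar>\<phi> (branch (Suc j) y) - \<phi> (branch j y)\<bar> \<le> L * \<bar>branch (Suc j) y - branch j y\<bar>"
    using lipschitz_onD[OF assms(1), of "branch (Suc j) y" "branch j y"]
      branch_mem[OF assms(3)] by (simp add: dist_real_def less_imp_le)
  also have "\<dots> \<le> L * (1 / (a * (a + 1) * \<theta>))"
    using branch_Suc_diff[OF assms(3)] L by (intro mult_left_mono) (auto simp: a_def)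
  finally have 2: "\<bar>\<phi> (branch (Suc j) y) - \<phi> (branch j y)\<bar> \<le> L * (1 / (a * (a + 1) * \<theta>))" .
  have "\<bar>(head (Suc j) x - head (Suc j) y) * (\<phi> (branch (Suc j) y) - \<phi> (branch j y))\<bar>
    \<le> (\<bar>x - y\<bar> / ((m + 1) * \<theta>)) * (L * (1 / (a * (a + 1) * \<theta>)))"
    unfolding abs_mult using theta_pos by (intro mult_mono 1 2) auto
  also have "\<dots> = L * \<bar>x - y\<bar> / ((m + 1) * (a * (a + 1))) * (1 / (\<theta> * \<theta>))"
    by (simp add: mult_ac)
  also have "1 / (\<theta> * \<theta>) = real m"
    using m_theta_theta theta_pos by (simp add: field_simps)
  also have "L * \<bar>x - y\<bar> / ((m + 1) * (a * (a + 1))) * real m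
      = L * \<bar>x - y\<bar> * (real m / (real m + 1)) * (1 / a - 1 / (a + 1))"
  proof -
    have "1 / a - 1 / (a + 1) = 1 / (a * (a + 1))" using a by (simp add: field_simps)
    then show ?thesis by (simp add: add.commute)
  qed
  finally show ?thesis by (simp add: a_def add_ac)
qed

text \<open>The difference of two values splits in two. Moving the arguments under fixed weights
  costs the factor \<open>1 / m\<close>, since the weights sum to 1 and the branches contract.
  Moving the weights under fixed arguments costs \<open>1 / (m + 1)\<close> after summation by
  parts. For \<open>m = 2\<close>, the worst case, the sum is 1/2 + 1/3.\<close>

lemma lipschitz_transfer:
  assumes "L-lipschitz_on {0..\<theta>} \<phi>"
  shows "(5/6 * L)-lipschitz_on {0..\<theta>} (transfer \<phi>)"
proof (rule lipschitz_onI)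
  show "0 \<le> 5/6 * L" using lipschitz_on_nonneg[OF assms] by simp
  have L: "0 \<le> L" by (rule lipschitz_on_nonneg[OF assms])
  fix x y assume "x \<in> {0..\<theta>}" "y \<in> {0..\<theta>}"
  then have xy: "0 \<le> x" "0 \<le> y" by auto
  define B where "B = \<bar>\<phi> 0\<bar> + L * \<theta>"
  have B: "\<bar>\<phi> z\<bar> \<le> B" if "z \<in> {0..\<theta>}" for z
    unfolding B_def by (rule lipschitz_bounded[OF assms that])
  define a where "a j = \<phi> (branch j y)" for j
  define d where "d j = head j x - head j y" for j
  define S where "S N = (\<Sum>j<N. weight j x * \<phi> (branch j x) - weight j y * a j)" for N
  have "S \<longlonglongrightarrow> transfer \<phi> x - transfer \<phi> y"
    using summable_transfer[of \<phi>, OF B] xy unfolding S_def transfer_def a_def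
    by (intro sums_diff[unfolded sums_def] summable_LIMSEQ)
      (auto intro: summable_norm_cancel)
  then have lim: "(\<lambda>N. \<bar>S N\<bar>) \<longlonglongrightarrow> \<bar>transfer \<phi> x - transfer \<phi> y\<bar>"
    by (rule tendsto_rabs)
  \<comment> \<open>Abel summation. The boundary term at index 0 vanishes because
    \<open>head 0\<close> is 0; the one at \<open>N\<close> stays.\<close>
  have parts: "(\<Sum>j<N. (weight j x - weight j y) * a j) = d N * a N - (\<Sum>j<N. d (Suc j) * (a (Suc j) - a j))" for N
  proof (induction N)
    case 0
    show ?case by (simp add: d_def head_def)
  next
    case (Suc N)
    have "weight N x - weight N y = d (Suc N) - d N" by (simp add: weight_def d_def)
    then have "(weight N x - weight N y) * a N = d (Suc N) * a N - d N * a N"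
      by (simp only: left_diff_distrib)
    moreover have "d (Suc N) * (a (Suc N) - a N) = d (Suc N) * a (Suc N) - d (Suc N) * a N"
      by (simp only: right_diff_distrib)
    ultimately show ?case using Suc by simp
  qed
  have bound: "\<bar>S N\<bar> \<le> 5/6 * L * \<bar>x - y\<bar> + B * \<bar>d N\<bar>" for N
  proof -
    have "S N = (\<Sum>j<N. weight j x * (\<phi> (branch j x) - a j)) + (\<Sum>j<N. (weight j x - weight j y) * a j)"
      unfolding S_def sum.distrib[symmetric] by (simp add: algebra_simps)
    then have eq: "S N = (\<Sum>j<N. weight j x * (\<phi> (branch j x) - a j)) + d N * a N
        - (\<Sum>j<N. d (Suc j) * (a (Suc j) - a j))"
      by (simp add: parts)
    have "\<bar>\<Sum>j<N. weight j x * (\<phi> (branch j x) - a j)\<bar> \<le> (\<Sum>j<N. weight j x * (L * (\<bar>x - y\<bar> / m)))"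
    proof (rule order_trans[OF sum_abs sum_mono])
      fix j
      have "\<bar>\<phi> (branch j x) - a j\<bar> \<le> L * \<bar>branch j x - branch j y\<bar>"
        using lipschitz_onD[OF assms, of "branch j x" "branch j y"]
          branch_mem xy by (simp add: dist_real_def less_imp_le a_def)
      also have "\<dots> \<le> L * (\<bar>x - y\<bar> / m)"
        using branch_diff[OF xy] L by (intro mult_left_mono) auto
      finally show "\<bar>weight j x * (\<phi> (branch j x) - a j)\<bar> \<le> weight j x * (L * (\<bar>x - y\<bar> / m))"
        using weight_nonneg[OF xy(1)] by (simp add: abs_mult mult_left_mono del: times_divide_eq_right)
    qed
    also have "\<dots> \<le> 1 * (L * (\<bar>x - y\<bar> / m))"
      unfolding sum_distrib_right[symmetric] using sum_weight_le_one[OF xy(1)] L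
      by (intro mult_right_mono) auto
    finally have 1: "\<bar>\<Sum>j<N. weight j x * (\<phi> (branch j x) - a j)\<bar> \<le> L * \<bar>x - y\<bar> * (1 / m)"
      by simp
    have "\<bar>\<Sum>j<N. d (Suc j) * (a (Suc j) - a j)\<bar> \<le>
      (\<Sum>j<N. L * \<bar>x - y\<bar> * (real m / (real m + 1)) * (1 / (real m + real j) - 1 / (real m + real (Suc j))))"
      using summation_by_parts_step[OF assms xy]
      by (intro order_trans[OF sum_abs sum_mono]) (simp add: d_def a_def)
    also have "\<dots> = L * \<bar>x - y\<bar> * (real m / (real m + 1)) * (1 / m - 1 / (real m + real N))"
      unfolding sum_distrib_left[symmetric] by (subst sum_lessThan_telescope') simp
    also have "\<dots> \<le> L * \<bar>x - y\<bar> * (real m / (real m + 1)) * (1 / m)"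
      using L by (intro mult_left_mono) auto
    also have "\<dots> = L * \<bar>x - y\<bar> * (1 / (real m + 1))"
      using m_ge_two by simp
    finally have 2: "\<bar>\<Sum>j<N. d (Suc j) * (a (Suc j) - a j)\<bar> \<le> L * \<bar>x - y\<bar> * (1 / (real m + 1))" .
    have 3: "\<bar>d N * a N\<bar> \<le> B * \<bar>d N\<bar>"
      using B[of "branch N y"] branch_mem[OF xy(2), of N]
      by (subst mult.commute) (auto simp: abs_mult a_def intro!: mult_right_mono)
    have "1 / real m \<le> 1/2" "1 / (real m + 1) \<le> 1/3"
      using m_ge_two by (auto simp: field_simps)
    then have "1 / m + 1 / (real m + 1) \<le> 5/6" by linarith
    then have 4: "L * \<bar>x - y\<bar> * (1 / m + 1 / (real m + 1)) \<le> L * \<bar>x - y\<bar> * (5/6)"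
      by (rule mult_left_mono) (use L in simp)
    from 1 2 3 4 show ?thesis
      unfolding eq distrib_left by linarith
  qed
  \<comment> \<open>Both heads tend to 1, so the boundary term left over from the summation by parts
    disappears in the limit.\<close>
  have "(\<lambda>N. d N) \<longlonglongrightarrow> 1 - 1"
    unfolding d_def using xy by (intro tendsto_intros head_tendsto_one)
  then have "(\<lambda>N. 5/6 * L * \<bar>x - y\<bar> + B * \<bar>d N\<bar>) \<longlonglongrightarrow> 5/6 * L * \<bar>x - y\<bar> + B * \<bar>1 - 1\<bar>"
    by (intro tendsto_intros)
  from LIMSEQ_le[OF lim this] bound
  show "dist (transfer \<phi> x) (transfer \<phi> y) \<le> 5/6 * L * dist x y"
    by (auto simp: dist_real_def)
qed

end

section \<open>Duality with composition\<close>

lemma set_integrable_bounded: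
  fixes f :: "real \<Rightarrow> real"
  assumes "f \<in> borel_measurable (lebesgue_on {a..b})" and "\<And>x. x \<in> {a..b} \<Longrightarrow> \<bar>f x\<bar> \<le> B"
  shows "set_integrable lebesgue {a..b} f"
  by (rule measurable_bounded_by_integrable_imp_absolutely_integrable[where g="\<lambda>_. B"])
    (use assms in auto)

lemma borel_measurable_lebesgue_on:
  assumes "f \<in> borel_measurable borel"
  shows "f \<in> borel_measurable (lebesgue_on S)"
  using assms by (auto intro!: measurable_restrict_space1 measurable_completion)

lemma borel_measurable_theta_map [measurable]: "theta_map \<theta> \<in> borel_measurable borel"
  unfolding theta_map_def by measurable

lemma borel_measurable_funpow_theta_map [measurable]: "theta_map \<theta> ^^ n \<in> borel_measurable borel"
proof (induction n)
  case (Suc n)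
  then show ?case unfolding funpow.simps by (rule measurable_comp) measurable
qed simp

context theta_expansion
begin

section \<open>The branches as inverses of the map, and the partition into cylinders\<close>

lemma floor_branch:
  assumes "t \<in> {0..<\<theta>}"
  shows "\<lfloor>1 / (branch j t * \<theta>)\<rfloor> = int (m + j)"
proof -
  have "1 / (branch j t * \<theta>) = real (m + j) + t / \<theta>"
    using theta_pos by (simp add: branch_def denom_def field_simps)
  moreover have "0 \<le> t / \<theta>" "t / \<theta> < 1"
    using assms theta_pos by auto
  ultimately show ?thesis by (intro floor_unique) auto
qed

lemma theta_map_branch:
  assumes "t \<in> {0..<\<theta>}"
  shows "theta_map \<theta> (branch j t) = t"
proof -
  have "branch j t \<noteq> 0" using branch_mem[of t j] assms by auto
  then have "theta_map \<theta> (branch j t) = denom j t - \<theta> * real (m + j)"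
    unfolding theta_map_def floor_branch[OF assms] by (simp add: branch_def)
  then show ?thesis by (simp add: denom_def algebra_simps)
qed

text \<open>The image is the cylinder of the digit \<open>m + j\<close>. The domain is half open
  because \<open>t = \<theta>\<close> would already produce the next digit; this makes the cylinders
  disjoint.\<close>

lemma branch_image:
  "branch j ` {0..<\<theta>} = {y \<in> {0<..\<theta>}. \<lfloor>1 / (y * \<theta>)\<rfloor> = int (m + j)}"
proof (intro equalityI subsetI)
  fix y assume "y \<in> branch j ` {0..<\<theta>}"
  then show "y \<in> {y \<in> {0<..\<theta>}. \<lfloor>1 / (y * \<theta>)\<rfloor> = int (m + j)}"
    using floor_branch branch_mem by auto
next
  fix y assume y: "y \<in> {y \<in> {0<..\<theta>}. \<lfloor>1 / (y * \<theta>)\<rfloor> = int (m + j)}"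
  \<comment> \<open>The only candidate for the preimage is the value of the map at \<open>y\<close>,
    with its digit inserted.\<close>
  define t where "t = 1 / y - real (m + j) * \<theta>"
  have fl: "real (m + j) \<le> 1 / (y * \<theta>)" "1 / (y * \<theta>) < real (m + j) + 1"
    using y by (auto simp: floor_eq_iff)
  have "1 / (y * \<theta>) * \<theta> = 1 / y" using theta_pos by simp
  then have "real (m + j) * \<theta> \<le> 1 / y" "1 / y < (real (m + j) + 1) * \<theta>"
    using mult_right_mono[OF fl(1), of \<theta>] mult_strict_right_mono[OF fl(2), of \<theta>] theta_pos by auto
  then have "t \<in> {0..<\<theta>}" by (auto simp: t_def algebra_simps)
  moreover have "branch j t = y" by (simp add: branch_def denom_def t_def)
  ultimately show "y \<in> branch j ` {0..<\<theta>}" by blast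
qed

text \<open>Every point of \<open>{0<..\<theta>}\<close> has a digit, and this is at least
  \<open>m\<close> because \<open>y * \<theta>\<close> is at most
  \<open>\<theta> * \<theta>\<close>, whose reciprocal is \<open>m\<close>.\<close>

lemma Union_branch_image: "(\<Union>j. branch j ` {0..<\<theta>}) = {0<..\<theta>}"
proof -
  have "\<exists>j. \<lfloor>1 / (y * \<theta>)\<rfloor> = int (m + j)" if "y \<in> {0<..\<theta>}" for y
  proof -
    have "y * \<theta> \<le> \<theta> * \<theta>" using that theta_pos by (intro mult_right_mono) auto
    then have "1 / (\<theta> * \<theta>) \<le> 1 / (y * \<theta>)"
      using that theta_pos by (intro divide_left_mono) auto
    moreover have "1 / (\<theta> * \<theta>) = real m"
      using m_theta_theta theta_pos by (simp add: field_simps)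
    ultimately have "int m \<le> \<lfloor>1 / (y * \<theta>)\<rfloor>" by (simp add: le_floor_iff)
    then show ?thesis by (intro exI[of _ "nat (\<lfloor>1 / (y * \<theta>)\<rfloor> - int m)"]) simp
  qed
  then show ?thesis unfolding branch_image by blast
qed

lemma disjoint_branch_image:
  "i \<noteq> j \<Longrightarrow> branch i ` {0..<\<theta>} \<inter> branch j ` {0..<\<theta>} = {}"
  unfolding branch_image by auto

lemma branch_image_sets [measurable]: "branch j ` {0..<\<theta>} \<in> sets borel"
  unfolding branch_image by measurable

lemma has_field_derivative_branch:
  assumes "0 \<le> t"
  shows "(branch j has_field_derivative - (branch j t)\<^sup>2) (at t within S)"
proof -
  have "((\<lambda>x. 1 / ((real m + real j) * \<theta> + x)) has_field_derivative
      - (1 / ((real m + real j) * \<theta> + t))\<^sup>2) (at t within S)"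
    using denom_pos[OF assms, of j] unfolding denom_def
    by (auto intro!: derivative_eq_intros simp: power2_eq_square)
  then show ?thesis by (simp add: branch_def[abs_def] denom_def)
qed

lemma inj_on_branch: "inj_on (branch j) {0..<\<theta>}"
  by (rule inj_on_inverseI[of _ "theta_map \<theta>"]) (rule theta_map_branch)

section \<open>Integrals against the invariant density\<close>

lemma invariant_density_pos: "0 \<le> x \<Longrightarrow> 0 < invariant_density x"
  using denom_pos[of x 0] by (simp add: invariant_density_def denom_def)

text \<open>The invariant density coincides with \<open>branch 0\<close>, whose values lie in
  \<open>{0<..\<theta>}\<close>.\<close>

lemma invariant_density_le:
  assumes "0 \<le> x"
  shows "invariant_density x \<le> \<theta>"
  using branch_mem[OF assms, of 0] by (simp add: branch_def denom_def invariant_density_def)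

lemma borel_measurable_invariant_density [measurable]: "invariant_density \<in> borel_measurable borel"
  unfolding invariant_density_def[abs_def] by measurable

lemma set_integrable_weighted:
  assumes "L-lipschitz_on {0..\<theta>} \<phi>"
    and "\<psi> \<in> borel_measurable borel" and "\<And>x. \<bar>\<psi> x\<bar> \<le> 1"
  shows "set_integrable lebesgue {0..\<theta>} (\<lambda>y. \<phi> y * invariant_density y * \<psi> y)"
proof (rule set_integrable_bounded)
  have "\<phi> \<in> borel_measurable (lebesgue_on {0..\<theta>})"
    by (intro continuous_imp_measurable_on_sets_lebesgue lipschitz_on_continuous_on[OF assms(1)]) simp
  moreover note borel_measurable_lebesgue_on[OF assms(2), of "{0..\<theta>}"]
    borel_measurable_lebesgue_on[OF borel_measurable_invariant_density, of "{0..\<theta>}"]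
  ultimately show "(\<lambda>y. \<phi> y * invariant_density y * \<psi> y) \<in> borel_measurable (lebesgue_on {0..\<theta>})"
    by (intro borel_measurable_times)
  fix y assume y: "y \<in> {0..\<theta>}"
  have "\<bar>\<phi> y * invariant_density y * \<psi> y\<bar> \<le> (\<bar>\<phi> 0\<bar> + L * \<theta>) * \<theta> * 1"
    unfolding abs_mult
    using lipschitz_bounded[OF assms(1) y] invariant_density_le[of y] invariant_density_pos[of y]
      assms(3)[of y] y theta_pos
    by (intro mult_mono) auto
  then show "\<bar>\<phi> y * invariant_density y * \<psi> y\<bar> \<le> (\<bar>\<phi> 0\<bar> + L * \<theta>) * \<theta> * 1" .
qed

text \<open>Cut the interval into the images of the branches and substitute
  \<open>y = branch j t\<close> on each. The map undoes the branch inside \<open>\<psi>\<close>, the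
  Jacobian turns the invariant density into a weight, and dominated convergence moves the sum over
  \<open>j\<close> inside the integral.\<close>

lemma transfer_duality:
  assumes lip: "L-lipschitz_on {0..\<theta>} \<phi>"
    and \<psi>: "\<psi> \<in> borel_measurable borel" "\<And>x. \<bar>\<psi> x\<bar> \<le> 1"
  shows "(LINT y:{0..\<theta>}|lebesgue. \<phi> y * invariant_density y * \<psi> (theta_map \<theta> y)) =
    (LINT t:{0..\<theta>}|lebesgue. transfer \<phi> t * invariant_density t * \<psi> t)"
proof -
  define f where "f y = \<phi> y * invariant_density y * \<psi> (theta_map \<theta> y)" for y
  define g where "g j t = weight j t * \<phi> (branch j t) * (invariant_density t * \<psi> t)" for j t
  define G where "G t = transfer \<phi> t * invariant_density t * \<psi> t" for t
  define B where "B = \<bar>\<phi> 0\<bar> + L * \<theta>"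
  have B: "\<bar>\<phi> z\<bar> \<le> B" if "z \<in> {0..\<theta>}" for z
    unfolding B_def by (rule lipschitz_bounded[OF lip that])
  then have B0: "0 \<le> B" using theta_pos by (meson abs_ge_zero atLeastAtMost_iff order_refl order_trans less_imp_le)
  have int_f: "set_integrable lebesgue {0..\<theta>} f"
    unfolding f_def using \<psi> by (intro set_integrable_weighted[OF lip]) auto
  have int_G: "set_integrable lebesgue {0..\<theta>} G"
    unfolding G_def by (rule set_integrable_weighted[OF lipschitz_transfer[OF lip] \<psi>])
  have drop_end: "(LINT y:{0..\<theta>}|lebesgue. h y) = (LINT y:S|lebesgue. h y)"
    if "set_integrable lebesgue {0..\<theta>} h" "S \<in> sets lebesgue" "S \<subseteq> {0..\<theta>}" "{0..\<theta>} - S \<subseteq> {0, \<theta>}"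
    for h :: "real \<Rightarrow> real" and S
  proof (rule set_integral_cong_set)
    show "set_borel_measurable lebesgue {0..\<theta>} h"
      using that(1) by (simp add: set_integrable_def set_borel_measurable_def)
    show "set_borel_measurable lebesgue S h"
      using set_integrable_subset[OF that(1,2,3)] by (simp add: set_integrable_def set_borel_measurable_def)
    have "negligible {0, \<theta>}" by simp
    then have "AE x in lebesgue. x \<notin> {0, \<theta>}"
      by (intro AE_not_in) (simp add: negligible_iff_null_sets)
    then show "AE x in lebesgue. x \<in> S \<longleftrightarrow> x \<in> {0..\<theta>}"
      by eventually_elim (use that(3,4) in auto)
  qed
  have piece: "set_integrable lebesgue {0..<\<theta>} (g j) \<and>
      (LINT y:branch j ` {0..<\<theta>}|lebesgue. f y) = (LINT t:{0..<\<theta>}|lebesgue. g j t)" for j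
  proof -
    have f_piece: "set_integrable lebesgue (branch j ` {0..<\<theta>}) f"
      using branch_mem by (intro set_integrable_subset[OF int_f]) (auto simp: less_imp_le)
    then have cv: "(\<lambda>t. \<bar>- (branch j t)\<^sup>2\<bar> * f (branch j t)) absolutely_integrable_on {0..<\<theta>} \<and>
        integral {0..<\<theta>} (\<lambda>t. \<bar>- (branch j t)\<^sup>2\<bar> * f (branch j t)) = integral (branch j ` {0..<\<theta>}) f"
      by (subst has_absolute_integral_change_of_variables_1')
        (auto intro: has_field_derivative_branch inj_on_branch)
    have eq: "\<bar>- (branch j t)\<^sup>2\<bar> * f (branch j t) = g j t" if "t \<in> {0..<\<theta>}" for t
      using weight_invariant_density[of t j] theta_map_branch[OF that] that
      by (simp add: f_def g_def mult_ac)
    have "set_integrable lebesgue {0..<\<theta>} (\<lambda>t. \<bar>- (branch j t)\<^sup>2\<bar> * f (branch j t)) =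
        set_integrable lebesgue {0..<\<theta>} (g j)"
      by (intro set_integrable_cong refl eq)
    with cv have int_g: "set_integrable lebesgue {0..<\<theta>} (g j)" by blast
    have "integral {0..<\<theta>} (\<lambda>t. \<bar>- (branch j t)\<^sup>2\<bar> * f (branch j t)) = integral {0..<\<theta>} (g j)"
      by (rule Henstock_Kurzweil_Integration.integral_cong) (rule eq)
    from trans[OF this[symmetric] conjunct2[OF cv]]
    have "integral {0..<\<theta>} (g j) = integral (branch j ` {0..<\<theta>}) f" .
    then show ?thesis
      using f_piece int_g by (simp add: set_lebesgue_integral_eq_integral(2))
  qed
  have "set_integrable lebesgue (\<Union>j. branch j ` {0..<\<theta>}) f"
    unfolding Union_branch_image by (rule set_integrable_subset[OF int_f]) auto
  from lebesgue_integral_countable_add[OF _ disjoint_branch_image this]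
  have "(LINT y:{0<..\<theta>}|lebesgue. f y) = (\<Sum>j. LINT t:{0..<\<theta>}|lebesgue. g j t)"
    using piece by (simp add: Union_branch_image)
  moreover have "(LINT y:{0..\<theta>}|lebesgue. f y) = (LINT y:{0<..\<theta>}|lebesgue. f y)"
    by (rule drop_end[OF int_f]) auto
  ultimately have suminf_f: "(LINT y:{0..\<theta>}|lebesgue. f y) = (\<Sum>j. LINT t:{0..<\<theta>}|lebesgue. g j t)"
    by simp
  \<comment> \<open>The dominating constant is \<open>B * \<theta>\<close>: partial sums of the
    weights are at most 1, \<open>\<phi>\<close> is bounded by \<open>B\<close>, the invariant
    density by \<open>\<theta>\<close> and \<open>\<psi>\<close> by 1.\<close>
  have "(\<lambda>N. LINT t|lebesgue. (\<Sum>j<N. indicator {0..<\<theta>} t *\<^sub>R g j t))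
      \<longlonglongrightarrow> (LINT t|lebesgue. indicator {0..<\<theta>} t *\<^sub>R G t)"
  proof (rule integral_dominated_convergence)
    have "set_integrable lebesgue {0..<\<theta>} G"
      by (rule set_integrable_subset[OF int_G]) auto
    then show "(\<lambda>t. indicator {0..<\<theta>} t *\<^sub>R G t) \<in> borel_measurable lebesgue"
      unfolding set_integrable_def by (rule borel_measurable_integrable)
    show "(\<lambda>t. \<Sum>j<N. indicator {0..<\<theta>} t *\<^sub>R g j t) \<in> borel_measurable lebesgue" for N
      using piece by (intro borel_measurable_sum) (auto simp: set_integrable_def)
    have "set_integrable lebesgue {0..<\<theta>} (\<lambda>_. B * \<theta>)"
      by (rule set_integrable_subset[of _ "{0..\<theta>}"]) auto
    then show "integrable lebesgue (\<lambda>t. indicator {0..<\<theta>} t *\<^sub>R (B * \<theta>))"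
      unfolding set_integrable_def .
    show "AE t in lebesgue. (\<lambda>N. \<Sum>j<N. indicator {0..<\<theta>} t *\<^sub>R g j t)
        \<longlonglongrightarrow> indicator {0..<\<theta>} t *\<^sub>R G t"
    proof (rule AE_I2)
      fix t :: real
      show "(\<lambda>N. \<Sum>j<N. indicator {0..<\<theta>} t *\<^sub>R g j t) \<longlonglongrightarrow> indicator {0..<\<theta>} t *\<^sub>R G t"
      proof (cases "t \<in> {0..<\<theta>}")
        case True
        then have "summable (\<lambda>j. norm (weight j t * \<phi> (branch j t)))"
          by (intro summable_transfer[OF B]) auto
        then have "(\<lambda>j. weight j t * \<phi> (branch j t)) sums transfer \<phi> t"
          unfolding transfer_def by (rule summable_sums[OF summable_norm_cancel])
        from sums_mult2[OF this, of "invariant_density t * \<psi> t"] True show ?thesis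
          by (simp add: sums_def g_def G_def mult_ac)
      qed simp
    qed
    show "AE t in lebesgue. norm (\<Sum>j<N. indicator {0..<\<theta>} t *\<^sub>R g j t)
        \<le> indicator {0..<\<theta>} t *\<^sub>R (B * \<theta>)" for N
    proof (rule AE_I2)
      fix t :: real
      show "norm (\<Sum>j<N. indicator {0..<\<theta>} t *\<^sub>R g j t) \<le> indicator {0..<\<theta>} t *\<^sub>R (B * \<theta>)"
      proof (cases "t \<in> {0..<\<theta>}")
        case True
        have "norm (\<Sum>j<N. g j t) \<le> (\<Sum>j<N. weight j t * (B * \<theta>))"
        proof (rule order_trans[OF norm_sum sum_mono])
          fix j
          have "\<bar>weight j t\<bar> * \<bar>\<phi> (branch j t)\<bar> * (\<bar>invariant_density t\<bar> * \<bar>\<psi> t\<bar>) \<le> weight j t * B * (\<theta> * 1)"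
            using True weight_nonneg[of t j] B[of "branch j t"] branch_mem[of t j]
              invariant_density_le[of t] invariant_density_pos[of t] \<psi>(2)[of t] theta_pos B0
            by (intro mult_mono) auto
          then show "norm (g j t) \<le> weight j t * (B * \<theta>)"
            by (simp add: g_def abs_mult mult_ac)
        qed
        also have "\<dots> \<le> 1 * (B * \<theta>)"
          unfolding sum_distrib_right[symmetric]
          using sum_weight_le_one[of t N] True B0 theta_pos by (intro mult_right_mono) auto
        finally show ?thesis using True by simp
      qed simp
    qed
  qed
  moreover have "(LINT t|lebesgue. (\<Sum>j<N. indicator {0..<\<theta>} t *\<^sub>R g j t))
      = (\<Sum>j<N. LINT t:{0..<\<theta>}|lebesgue. g j t)" for N
    using piece unfolding set_lebesgue_integral_def set_integrable_def
    by (intro Bochner_Integration.integral_sum) auto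
  ultimately have "(\<lambda>j. LINT t:{0..<\<theta>}|lebesgue. g j t) sums (LINT t:{0..<\<theta>}|lebesgue. G t)"
    by (simp add: sums_def set_lebesgue_integral_def)
  then have "(LINT y:{0..\<theta>}|lebesgue. f y) = (LINT t:{0..<\<theta>}|lebesgue. G t)"
    using suminf_f by (simp add: sums_iff)
  also have "\<dots> = (LINT t:{0..\<theta>}|lebesgue. G t)"
    by (rule drop_end[OF int_G, symmetric]) auto
  finally show ?thesis by (simp add: f_def G_def)
qed

section \<open>Geometric convergence\<close>

lemma lipschitz_funpow_transfer:
  assumes "L-lipschitz_on {0..\<theta>} \<phi>"
  shows "((5/6) ^ n * L)-lipschitz_on {0..\<theta>} ((transfer ^^ n) \<phi>)"
proof (induction n)
  case (Suc n)
  show ?case using lipschitz_transfer[OF Suc] by (simp add: mult.assoc)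
qed (use assms in simp)

text \<open>Each application of \<open>transfer_duality\<close> moves one iterate from the test
  function to \<open>\<phi>\<close>. The induction therefore generalises over \<open>\<phi>\<close>
  and its Lipschitz constant.\<close>

lemma funpow_transfer_duality:
  assumes "L-lipschitz_on {0..\<theta>} \<phi>"
    and "\<psi> \<in> borel_measurable borel" "\<And>x. \<bar>\<psi> x\<bar> \<le> 1"
  shows "(LINT y:{0..\<theta>}|lebesgue. \<phi> y * invariant_density y * \<psi> ((theta_map \<theta> ^^ n) y)) =
    (LINT t:{0..\<theta>}|lebesgue. (transfer ^^ n) \<phi> t * invariant_density t * \<psi> t)"
  using assms(1)
proof (induction n arbitrary: \<phi> L)
  case (Suc n)
  have "(LINT y:{0..\<theta>}|lebesgue. \<phi> y * invariant_density y * \<psi> ((theta_map \<theta> ^^ Suc n) y)) =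
    (LINT t:{0..\<theta>}|lebesgue. transfer \<phi> t * invariant_density t * \<psi> ((theta_map \<theta> ^^ n) t))"
    using transfer_duality[OF Suc.prems, of "\<lambda>y. \<psi> ((theta_map \<theta> ^^ n) y)"] assms(2,3)
    by (simp add: funpow_swap1 measurable_compose[OF borel_measurable_funpow_theta_map])
  also have "\<dots> = (LINT t:{0..\<theta>}|lebesgue. (transfer ^^ n) (transfer \<phi>) t * invariant_density t * \<psi> t)"
    by (rule Suc.IH[OF lipschitz_transfer[OF Suc.prems]])
  finally show ?case by (simp add: funpow_swap1)
qed simp

section \<open>Masses of intervals under the invariant density\<close>

lemma invariant_density_integral:
  assumes "x \<in> {0..\<theta>}"
  shows "(LINT t:{0..\<theta>}|lebesgue. invariant_density t * indicator {..<x} t) = ln ((real m * \<theta> + x) * \<theta>)"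
proof -
  have const: "0-lipschitz_on {0..\<theta>} (\<lambda>_. 1 :: real)"
    by (rule lipschitz_on_constant)
  have int: "set_integrable lebesgue {0..\<theta>} invariant_density"
    using set_integrable_weighted[OF const, of "\<lambda>_. 1"] by simp
  have "(LINT t:{0..\<theta>}|lebesgue. invariant_density t * indicator {..<x} t) = (LINT t:{0..<x}|lebesgue. invariant_density t)"
    using assms unfolding set_lebesgue_integral_def
    by (intro Bochner_Integration.integral_cong) (auto simp: indicator_def)
  also have "\<dots> = integral {0..<x} invariant_density"
    using assms by (intro set_lebesgue_integral_eq_integral(2) set_integrable_subset[OF int]) auto
  also have "\<dots> = integral {0..x} invariant_density"
    by (rule integral_subset_negligible) (auto intro: negligible_subset[of "{x}"])
  \<comment> \<open>The factor \<open>\<theta>\<close> inside the logarithm normalises the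
    antiderivative: its argument at 0 is \<open>real m * \<theta> * \<theta>\<close>, which is
    1.\<close>
  also have "\<dots> = ln ((real m * \<theta> + x) * \<theta>) - ln ((real m * \<theta> + 0) * \<theta>)"
  proof (intro integral_unique fundamental_theorem_of_calculus)
    fix t assume "t \<in> {0..x}"
    then have "0 < real m * \<theta> + t" using denom_pos[of t 0] by (simp add: denom_def)
    then have "0 < (real m * \<theta> + t) * \<theta>" "real m * \<theta> + t \<noteq> 0" using theta_pos by auto
    then show "((\<lambda>t. ln ((real m * \<theta> + t) * \<theta>)) has_vector_derivative invariant_density t) (at t within {0..x})"
      unfolding has_real_derivative_iff_has_vector_derivative[symmetric] invariant_density_def
      using theta_pos by (auto intro!: derivative_eq_intros)
  qed (use assms in simp)
  also have "(real m * \<theta> + 0) * \<theta> = 1" using m_theta_theta by (simp add: mult.assoc)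
  finally show ?thesis by simp
qed

lemma ln_gauss_nonneg:
  assumes "0 \<le> x"
  shows "0 \<le> ln ((real m * \<theta> + x) * \<theta>)"
proof -
  have "(real m * \<theta> + x) * \<theta> = 1 + x * \<theta>" using m_theta_theta by (simp add: algebra_simps)
  then show ?thesis using assms theta_pos by simp
qed

lemma ln_one_plus_theta_square: "ln (1 + \<theta>\<^sup>2) = ln ((real m * \<theta> + \<theta>) * \<theta>)"
proof -
  have "(real m * \<theta> + \<theta>) * \<theta> = 1 + \<theta>\<^sup>2" using m_theta_theta by (simp add: algebra_simps power2_eq_square)
  then show ?thesis by simp
qed

lemma ln_one_plus_theta_square_pos: "0 < ln (1 + \<theta>\<^sup>2)"
  using theta_pos by (intro ln_gt_zero) simp

lemma invariant_density_total:
  "(LINT t:{0..\<theta>}|lebesgue. invariant_density t) = ln (1 + \<theta>\<^sup>2)"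
proof -
  have const: "0-lipschitz_on {0..\<theta>} (\<lambda>_. 1 :: real)"
    by (rule lipschitz_on_constant)
  have int: "set_integrable lebesgue {0..\<theta>} invariant_density"
    "set_integrable lebesgue {0..\<theta>} (\<lambda>t. invariant_density t * indicator {..<\<theta>} t)"
    using set_integrable_weighted[OF const, of "\<lambda>_. 1"] 
      set_integrable_weighted[OF const, of "indicator {..<\<theta>}"] by simp_all
  have "AE t in lebesgue. t \<noteq> \<theta>"
    using AE_not_in[of "{\<theta>}" lebesgue] by (simp add: negligible_iff_null_sets[symmetric])
  then have "(LINT t:{0..\<theta>}|lebesgue. invariant_density t) =
      (LINT t:{0..\<theta>}|lebesgue. invariant_density t * indicator {..<\<theta>} t)"
    using int unfolding set_lebesgue_integral_def set_integrable_def
    by (intro integral_cong_AE) (auto elim!: eventually_mono simp: indicator_def)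
  also have "\<dots> = ln (1 + \<theta>\<^sup>2)"
    using invariant_density_integral[of \<theta>] theta_pos by (simp add: ln_one_plus_theta_square)
  finally show ?thesis .
qed

section \<open>Convergence of the iterates to the mean\<close>

definition mean :: "(real \<Rightarrow> real) \<Rightarrow> real" where
  "mean \<phi> = (LINT t:{0..\<theta>}|lebesgue. \<phi> t * invariant_density t) / ln (1 + \<theta>\<^sup>2)"

text \<open>The bound keeps the mass weighted by \<open>\<psi>\<close> instead of the total mass.
  For the indicator of \<open>{..<x}\<close> the error is then proportional to
  \<open>ln ((real m * \<theta> + x) * \<theta>)\<close>, which the multiplicative error form needs
  near \<open>x = 0\<close>.\<close>

lemma weighted_abs_le:
  assumes "K-lipschitz_on {0..\<theta>} u" and "\<And>s. s \<in> {0..\<theta>} \<Longrightarrow> \<bar>u s\<bar> \<le> C"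
    and \<psi>: "\<psi> \<in> borel_measurable borel" "\<And>x. \<bar>\<psi> x\<bar> \<le> 1" "\<And>x. 0 \<le> \<psi> x"
  shows "\<bar>LINT s:{0..\<theta>}|lebesgue. u s * invariant_density s * \<psi> s\<bar>
    \<le> C * (LINT s:{0..\<theta>}|lebesgue. invariant_density s * \<psi> s)"
proof -
  have const: "0-lipschitz_on {0..\<theta>} (\<lambda>_. 1 :: real)"
    by (rule lipschitz_on_constant)
  have int: "set_integrable lebesgue {0..\<theta>} (\<lambda>s. u s * invariant_density s * \<psi> s)"
    by (rule set_integrable_weighted[OF assms(1) \<psi>(1,2)])
  have int1: "set_integrable lebesgue {0..\<theta>} (\<lambda>s. invariant_density s * \<psi> s)"
    using set_integrable_weighted[OF const \<psi>(1,2)] by simp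
  have "\<bar>LINT s:{0..\<theta>}|lebesgue. u s * invariant_density s * \<psi> s\<bar>
      \<le> (LINT s:{0..\<theta>}|lebesgue. \<bar>u s * invariant_density s * \<psi> s\<bar>)"
    using set_integral_norm_bound[OF int] by simp
  also have "\<dots> \<le> (LINT s:{0..\<theta>}|lebesgue. C * (invariant_density s * \<psi> s))"
  proof (rule set_integral_mono)
    show "set_integrable lebesgue {0..\<theta>} (\<lambda>s. \<bar>u s * invariant_density s * \<psi> s\<bar>)"
      using set_integrable_abs[OF int] by simp
    show "set_integrable lebesgue {0..\<theta>} (\<lambda>s. C * (invariant_density s * \<psi> s))"
      using int1 by simp
    fix s assume s: "s \<in> {0..\<theta>}"
    have "\<bar>u s\<bar> * (\<bar>invariant_density s\<bar> * \<bar>\<psi> s\<bar>) \<le> C * (\<bar>invariant_density s\<bar> * \<bar>\<psi> s\<bar>)"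
      using assms(2)[OF s] by (intro mult_right_mono) auto
    then show "\<bar>u s * invariant_density s * \<psi> s\<bar> \<le> C * (invariant_density s * \<psi> s)"
      using \<psi>(3)[of s] invariant_density_pos[of s] s by (simp add: abs_mult mult.assoc)
  qed
  finally show ?thesis by simp
qed

text \<open>By duality with the constant test function 1, all iterates have the same mean as
  \<open>\<phi>\<close>. A function with Lipschitz constant \<open>K\<close> on an interval of
  length \<open>\<theta>\<close> differs from any weighted average of its values by at most
  \<open>\<theta> * K\<close>.\<close>

lemma funpow_transfer_near_mean:
  assumes lip: "L-lipschitz_on {0..\<theta>} \<phi>" and t: "t \<in> {0..\<theta>}"
  shows "\<bar>(transfer ^^ n) \<phi> t - mean \<phi>\<bar> \<le> \<theta> * ((5/6) ^ n * L)"
proof -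
  define u where "u = (transfer ^^ n) \<phi>"
  define K where "K = (5/6) ^ n * L"
  have uK: "K-lipschitz_on {0..\<theta>} u"
    unfolding u_def K_def by (rule lipschitz_funpow_transfer[OF lip])
  have const: "0-lipschitz_on {0..\<theta>} (\<lambda>_. c :: real)" for c
    by (rule lipschitz_on_constant)
  have K: "0 \<le> K" by (rule lipschitz_on_nonneg[OF uK])
  have vK: "(0 + K)-lipschitz_on {0..\<theta>} (\<lambda>s. u t - u s)"
    by (intro lipschitz_on_diff const uK)
  have "\<bar>u t - u s\<bar> \<le> \<theta> * K" if "s \<in> {0..\<theta>}" for s
  proof -
    have "\<bar>u t - u s\<bar> \<le> K * \<bar>t - s\<bar>"
      using lipschitz_onD[OF uK t that] by (simp add: dist_real_def)
    also have "\<dots> \<le> K * \<theta>" using t that K by (intro mult_left_mono) auto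
    finally show ?thesis by (simp add: mult.commute)
  qed
  from weighted_abs_le[OF vK this, of "\<lambda>_. 1"]
  have bd: "\<bar>LINT s:{0..\<theta>}|lebesgue. (u t - u s) * invariant_density s\<bar> \<le> \<theta> * K * ln (1 + \<theta>\<^sup>2)"
    by (simp add: invariant_density_total)
  have "(LINT s:{0..\<theta>}|lebesgue. (u t - u s) * invariant_density s) =
      (LINT s:{0..\<theta>}|lebesgue. u t * invariant_density s) - (LINT s:{0..\<theta>}|lebesgue. u s * invariant_density s)"
    using set_integrable_weighted[OF const[of "u t"], of "\<lambda>_. 1"] set_integrable_weighted[OF uK, of "\<lambda>_. 1"]
    by (simp add: left_diff_distrib set_integral_diff(2))
  also have "(LINT s:{0..\<theta>}|lebesgue. u s * invariant_density s) = (LINT s:{0..\<theta>}|lebesgue. \<phi> s * invariant_density s)"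
    using funpow_transfer_duality[OF lip, of "\<lambda>_. 1" n] by (simp add: u_def)
  also have "\<dots> = mean \<phi> * ln (1 + \<theta>\<^sup>2)"
    using ln_one_plus_theta_square_pos by (simp add: mean_def)
  also have "(LINT s:{0..\<theta>}|lebesgue. u t * invariant_density s) = u t * ln (1 + \<theta>\<^sup>2)"
    by (simp add: invariant_density_total)
  finally have "\<bar>u t - mean \<phi>\<bar> * ln (1 + \<theta>\<^sup>2) \<le> \<theta> * K * ln (1 + \<theta>\<^sup>2)"
    using bd ln_one_plus_theta_square_pos by (simp add: left_diff_distrib[symmetric] abs_mult)
  then show ?thesis
    using ln_one_plus_theta_square_pos by (simp add: u_def K_def)
qed

text \<open>Duality replaces the iterated map by the iterated operator; the pointwise distance to
  the mean is then integrated against the invariant density over the points below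
  \<open>x\<close>.\<close>

lemma gauss_kuzmin_lipschitz:
  assumes lip: "L-lipschitz_on {0..\<theta>} \<phi>" and x: "x \<in> {0..\<theta>}"
  shows "\<bar>(LINT y:{0..\<theta>}|lebesgue. \<phi> y * invariant_density y * indicator {..<x} ((theta_map \<theta> ^^ n) y))
      - mean \<phi> * ln ((real m * \<theta> + x) * \<theta>)\<bar>
    \<le> \<theta> * ((5/6) ^ n * L) * ln ((real m * \<theta> + x) * \<theta>)"
proof -
  define u where "u = (transfer ^^ n) \<phi>"
  define K where "K = (5/6) ^ n * L"
  define \<psi> :: "real \<Rightarrow> real" where "\<psi> = indicator {..<x}"
  have \<psi>: "\<psi> \<in> borel_measurable borel" "\<bar>\<psi> s\<bar> \<le> 1" "0 \<le> \<psi> s" for s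
    by (auto simp: \<psi>_def indicator_def)
  have uK: "K-lipschitz_on {0..\<theta>} u"
    unfolding u_def K_def by (rule lipschitz_funpow_transfer[OF lip])
  have const: "0-lipschitz_on {0..\<theta>} (\<lambda>_. c :: real)" for c
    by (rule lipschitz_on_constant)
  have vK: "(K + 0)-lipschitz_on {0..\<theta>} (\<lambda>s. u s - mean \<phi>)"
    by (intro lipschitz_on_diff const uK)
  have \<psi>_int: "(LINT s:{0..\<theta>}|lebesgue. invariant_density s * \<psi> s) = ln ((real m * \<theta> + x) * \<theta>)"
    unfolding \<psi>_def by (rule invariant_density_integral[OF x])
  have "(LINT s:{0..\<theta>}|lebesgue. (u s - mean \<phi>) * invariant_density s * \<psi> s) =
      (LINT s:{0..\<theta>}|lebesgue. u s * invariant_density s * \<psi> s)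
      - (LINT s:{0..\<theta>}|lebesgue. mean \<phi> * invariant_density s * \<psi> s)"
    using set_integrable_weighted[OF const[of "mean \<phi>"] \<psi>(1,2)] set_integrable_weighted[OF uK \<psi>(1,2)]
    by (simp only: left_diff_distrib set_integral_diff(2))
  also have "(LINT s:{0..\<theta>}|lebesgue. mean \<phi> * invariant_density s * \<psi> s) = mean \<phi> * ln ((real m * \<theta> + x) * \<theta>)"
    using \<psi>_int by (simp add: mult.assoc)
  also have "(LINT s:{0..\<theta>}|lebesgue. u s * invariant_density s * \<psi> s) =
      (LINT y:{0..\<theta>}|lebesgue. \<phi> y * invariant_density y * \<psi> ((theta_map \<theta> ^^ n) y))"
    unfolding u_def by (rule funpow_transfer_duality[OF lip \<psi>(1,2), symmetric])
  finally show ?thesis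
    using weighted_abs_le[OF vK _ \<psi>(1,2,3), of "\<theta> * K"] funpow_transfer_near_mean[OF lip, of _ n]
    by (simp add: \<psi>_int[unfolded \<psi>_def] u_def K_def \<psi>_def)
qed

end

section \<open>Densities\<close>

lemma lipschitz_on_mult_bounded:
  fixes f g :: "real \<Rightarrow> real"
  assumes "L-lipschitz_on S f" "K-lipschitz_on S g"
    and "\<And>x. x \<in> S \<Longrightarrow> \<bar>f x\<bar> \<le> A" "\<And>x. x \<in> S \<Longrightarrow> \<bar>g x\<bar> \<le> B" and "0 \<le> A" "0 \<le> B"
  shows "(L * B + A * K)-lipschitz_on S (\<lambda>x. f x * g x)"
proof (rule lipschitz_onI)
  have LK: "0 \<le> L" "0 \<le> K" using assms(1,2) by (simp_all add: lipschitz_on_nonneg)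
  then show "0 \<le> L * B + A * K" using assms(5,6) by simp
  fix x y assume xy: "x \<in> S" "y \<in> S"
  have "f x * g x - f y * g y = (f x - f y) * g x + f y * (g x - g y)"
    by (simp add: algebra_simps)
  then have "\<bar>f x * g x - f y * g y\<bar> \<le> \<bar>f x - f y\<bar> * \<bar>g x\<bar> + \<bar>f y\<bar> * \<bar>g x - g y\<bar>"
    by (metis abs_mult abs_triangle_ineq)
  also have "\<dots> \<le> (L * \<bar>x - y\<bar>) * B + A * (K * \<bar>x - y\<bar>)"
    using lipschitz_onD[OF assms(1) xy] lipschitz_onD[OF assms(2) xy] assms(3-6) xy LK
    by (intro add_mono mult_mono) (auto simp: dist_real_def)
  finally show "dist (f x * g x) (f y * g y) \<le> (L * B + A * K) * dist x y"
    by (simp add: dist_real_def algebra_simps)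
qed

lemma real_polynomial_function_lipschitz:
  fixes p :: "real \<Rightarrow> real"
  assumes "real_polynomial_function p"
  obtains L where "L-lipschitz_on {a..b} p"
proof -
  obtain p' where p': "real_polynomial_function p'" "\<And>x. (p has_real_derivative p' x) (at x)"
    using has_real_derivative_polynomial_function[OF assms] by blast
  have "continuous_on {a..b} p'"
    using p'(1) by (simp add: continuous_on_polymonial_function real_polynomial_function_eq)
  then have "bounded (p' ` {a..b})"
    by (intro compact_imp_bounded compact_continuous_image) auto
  then obtain B where B: "0 < B" "\<And>x. x \<in> {a..b} \<Longrightarrow> \<bar>p' x\<bar> \<le> B"
    by (auto simp: bounded_pos)
  have "B-lipschitz_on {a..b} p"
  proof (rule bounded_derivative_imp_lipschitz)
    show "(p has_derivative (*) (p' x)) (at x within {a..b})" for x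
      using p'(2)[of x] by (auto simp: has_field_derivative_def intro: has_derivative_at_withinI)
    show "onorm ((*) (p' x)) \<le> B" if "x \<in> {a..b}" for x
      using B(2)[OF that] by (intro onorm_le) (auto simp: abs_mult intro: mult_right_mono)
  qed (use B in auto)
  then show thesis by (rule that)
qed

text \<open>Three approximations cost \<open>e/3\<close> each: truncating \<open>h\<close> at height
  \<open>k\<close>, replacing the truncation by a continuous function, and replacing that by a
  polynomial, which is Lipschitz on a bounded interval.\<close>

lemma lipschitz_L1_approximation:
  fixes h :: "real \<Rightarrow> real"
  assumes h: "set_integrable lebesgue {a..b} h" and "0 < e"
  obtains L p where "L-lipschitz_on {a..b} p" "(LINT y:{a..b}|lebesgue. \<bar>h y - p y\<bar>) < e"
proof -
  define clip :: "nat \<Rightarrow> real \<Rightarrow> real" where "clip k y = max (- real k) (min (real k) y)" for k y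
  have clip_cont: "continuous_on UNIV (clip k)" for k
    unfolding clip_def[abs_def] by (intro continuous_intros)
  then have clip_meas [measurable]: "clip k \<in> borel_measurable borel" for k
    by (rule borel_measurable_continuous_onI)
  have clip_le: "\<bar>clip k y\<bar> \<le> real k" for k y by (auto simp: clip_def)
  have h_meas: "h \<in> borel_measurable (lebesgue_on {a..b})"
    by (rule absolutely_integrable_imp_borel_measurable[OF h]) simp
  then have clip_h: "set_integrable lebesgue {a..b} (\<lambda>y. clip k (h y))" for k
    using clip_le by (intro set_integrable_bounded[where B="real k"]) auto
  have "(\<lambda>k. LINT y|lebesgue. indicator {a..b} y *\<^sub>R \<bar>h y - clip k (h y)\<bar>) \<longlonglongrightarrow> (LINT y::real|lebesgue. 0 :: real)"
  proof (rule integral_dominated_convergence)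
    show "integrable lebesgue (\<lambda>y. indicator {a..b} y *\<^sub>R \<bar>h y\<bar>)"
      using set_integrable_abs[OF h] by (simp add: set_integrable_def)
    show "(\<lambda>y. indicator {a..b} y *\<^sub>R \<bar>h y - clip k (h y)\<bar>) \<in> borel_measurable lebesgue" for k
      using set_integrable_abs[OF set_integral_diff(1)[OF h clip_h[of k]]] by (auto simp: set_integrable_def)
    show "AE y in lebesgue. norm (indicator {a..b} y *\<^sub>R \<bar>h y - clip k (h y)\<bar>) \<le> indicator {a..b} y *\<^sub>R \<bar>h y\<bar>" for k
      by (rule AE_I2) (auto simp: indicator_def clip_def)
    show "AE y in lebesgue. (\<lambda>k. indicator {a..b} y *\<^sub>R \<bar>h y - clip k (h y)\<bar>) \<longlonglongrightarrow> 0"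
    proof (rule AE_I2)
      fix y
      obtain N where N: "\<bar>h y\<bar> \<le> real N" using real_arch_simple by blast
      have "indicator {a..b} y *\<^sub>R \<bar>h y - clip k (h y)\<bar> = 0" if "k \<ge> N" for k
        using N that by (auto simp: clip_def)
      then show "(\<lambda>k. indicator {a..b} y *\<^sub>R \<bar>h y - clip k (h y)\<bar>) \<longlonglongrightarrow> 0"
        by (intro tendsto_eventually) (auto simp: eventually_sequentially)
    qed
  qed simp
  then have "eventually (\<lambda>k. (LINT y:{a..b}|lebesgue. \<bar>h y - clip k (h y)\<bar>) < e/3) sequentially"
    using \<open>0 < e\<close> by (intro order_tendstoD(2)) (auto simp: set_lebesgue_integral_def)
  then obtain k where k: "(LINT y:{a..b}|lebesgue. \<bar>h y - clip k (h y)\<bar>) < e/3"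
    by (auto simp: eventually_sequentially)
  \<comment> \<open>Measurability supplies continuous functions converging to \<open>h\<close> off a
    null set. They need not be dominated, so they are clipped as well, which bounds the differences
    by \<open>2 * real k\<close>.\<close>
  from h_meas have "h measurable_on {a..b}" by (simp add: measurable_on_iff_borel_measurable)
  then obtain N g where N: "negligible N" and g: "\<And>n. continuous_on UNIV (g n)"
    and lim: "\<And>x. x \<notin> N \<Longrightarrow> (\<lambda>n. g n x) \<longlonglongrightarrow> (if x \<in> {a..b} then h x else 0)"
    unfolding measurable_on_def by blast
  have cont_g: "continuous_on UNIV (\<lambda>y. clip k (g n y))" for n
    using clip_cont[of k] g[of n] by (rule continuous_on_compose2) auto
  then have clip_g: "set_integrable lebesgue {a..b} (\<lambda>y. clip k (g n y))" for n
    using clip_le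
    by (intro set_integrable_bounded[where B="real k"] borel_measurable_lebesgue_on borel_measurable_continuous_onI)
  have "(\<lambda>n. LINT y|lebesgue. indicator {a..b} y *\<^sub>R \<bar>clip k (h y) - clip k (g n y)\<bar>) \<longlonglongrightarrow> (LINT y::real|lebesgue. 0 :: real)"
  proof (rule integral_dominated_convergence)
    show "integrable lebesgue (\<lambda>y. indicator {a..b} y *\<^sub>R (2 * real k))"
      by (subst set_integrable_def[symmetric]) simp
    show "(\<lambda>y. indicator {a..b} y *\<^sub>R \<bar>clip k (h y) - clip k (g n y)\<bar>) \<in> borel_measurable lebesgue" for n
      using set_integrable_abs[OF set_integral_diff(1)[OF clip_h[of k] clip_g[of n]]] by (auto simp: set_integrable_def)
    show "AE y in lebesgue. norm (indicator {a..b} y *\<^sub>R \<bar>clip k (h y) - clip k (g n y)\<bar>) \<le> indicator {a..b} y *\<^sub>R (2 * real k)" for n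
      by (rule AE_I2) (auto simp: indicator_def clip_def)
    have "AE y in lebesgue. y \<notin> N"
      using N by (intro AE_not_in) (simp add: negligible_iff_null_sets)
    then show "AE y in lebesgue. (\<lambda>n. indicator {a..b} y *\<^sub>R \<bar>clip k (h y) - clip k (g n y)\<bar>) \<longlonglongrightarrow> 0"
    proof eventually_elim
      case (elim y)
      show ?case
      proof (cases "y \<in> {a..b}")
        case True
        then have "(\<lambda>n. clip k (g n y)) \<longlonglongrightarrow> clip k (h y)"
          using lim[OF elim] by (intro continuous_on_tendsto_compose[OF clip_cont]) auto
        then have "(\<lambda>n. \<bar>clip k (h y) - clip k (g n y)\<bar>) \<longlonglongrightarrow> \<bar>clip k (h y) - clip k (h y)\<bar>"
          by (intro tendsto_intros)
        then show ?thesis using True by simp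
      qed simp
    qed
  qed simp
  then have "eventually (\<lambda>n. (LINT y:{a..b}|lebesgue. \<bar>clip k (h y) - clip k (g n y)\<bar>) < e/3) sequentially"
    using \<open>0 < e\<close> by (intro order_tendstoD(2)) (auto simp: set_lebesgue_integral_def)
  then obtain n where n: "(LINT y:{a..b}|lebesgue. \<bar>clip k (h y) - clip k (g n y)\<bar>) < e/3"
    by (auto simp: eventually_sequentially)
  \<comment> \<open>Uniform accuracy \<open>d\<close> costs at most \<open>d\<close> times the
    length of the interval; the summand 1 keeps the denominator positive when
    \<open>a = b\<close>.\<close>
  define d where "d = e / (3 * (\<bar>b - a\<bar> + 1))"
  have "0 < d" using \<open>0 < e\<close> unfolding d_def by (intro divide_pos_pos mult_pos_pos add_nonneg_pos) auto
  then obtain p where p: "real_polynomial_function p" "\<And>y. y \<in> {a..b} \<Longrightarrow> \<bar>clip k (g n y) - p y\<bar> < d"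
    using Stone_Weierstrass_real_polynomial_function[of "{a..b}" "\<lambda>y. clip k (g n y)" d]
      continuous_on_subset[OF cont_g] by blast
  obtain L where L: "L-lipschitz_on {a..b} p"
    using real_polynomial_function_lipschitz[OF p(1)] by blast
  have p_int: "set_integrable lebesgue {a..b} p"
    by (intro absolutely_integrable_continuous_real lipschitz_on_continuous_on[OF L])
  have int1: "set_integrable lebesgue {a..b} (\<lambda>y. \<bar>h y - clip k (h y)\<bar>)"
    by (intro set_integrable_abs set_integral_diff h clip_h)
  have int2: "set_integrable lebesgue {a..b} (\<lambda>y. \<bar>clip k (h y) - clip k (g n y)\<bar>)"
    by (intro set_integrable_abs set_integral_diff clip_g clip_h)
  have int3: "set_integrable lebesgue {a..b} (\<lambda>y. d)" by simp
  have "(LINT y:{a..b}|lebesgue. \<bar>h y - p y\<bar>)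
      \<le> (LINT y:{a..b}|lebesgue. \<bar>h y - clip k (h y)\<bar> + \<bar>clip k (h y) - clip k (g n y)\<bar> + d)"
  proof (rule set_integral_mono)
    show "set_integrable lebesgue {a..b} (\<lambda>y. \<bar>h y - p y\<bar>)"
      by (intro set_integrable_abs set_integral_diff h p_int)
    show "set_integrable lebesgue {a..b} (\<lambda>y. \<bar>h y - clip k (h y)\<bar> + \<bar>clip k (h y) - clip k (g n y)\<bar> + d)"
      by (intro set_integral_add int1 int2 int3)
    show "\<bar>h y - p y\<bar> \<le> \<bar>h y - clip k (h y)\<bar> + \<bar>clip k (h y) - clip k (g n y)\<bar> + d" if "y \<in> {a..b}" for y
      using p(2)[OF that] by linarith
  qed
  also have "\<dots> = (LINT y:{a..b}|lebesgue. \<bar>h y - clip k (h y)\<bar>)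
      + (LINT y:{a..b}|lebesgue. \<bar>clip k (h y) - clip k (g n y)\<bar>) + (LINT y:{a..b}|lebesgue. d)"
    using int1 int2 int3 by (simp add: set_integral_add)
  also have "(LINT y:{a..b}|lebesgue. d) \<le> e/3"
  proof -
    have "(LINT y:{a..b}|lebesgue. d) = d * max 0 (b - a)"
      by (subst set_lebesgue_integral_eq_integral(2)[OF int3]) (auto simp: max_def not_le)
    also have "\<dots> \<le> d * (\<bar>b - a\<bar> + 1)"
      using \<open>0 < d\<close> by (intro mult_left_mono) auto
    also have "\<dots> = e/3"
    proof -
      define v where "v = \<bar>b - a\<bar> + 1"
      have "v \<noteq> 0" unfolding v_def by linarith
      then show ?thesis unfolding d_def v_def[symmetric] by simp
    qed
    finally show ?thesis .
  qed
  finally have "(LINT y:{a..b}|lebesgue. \<bar>h y - p y\<bar>) < e" using k n by simp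
  with L show thesis by (rule that)
qed

context theta_expansion
begin

section \<open>Limit laws for Lipschitz and for integrable densities\<close>

lemma invariant_density_recip:
  assumes "0 \<le> y"
  shows "g y * (real m * \<theta> + y) * invariant_density y = g y"
  using denom_pos[OF assms, of 0] by (simp add: invariant_density_def denom_def)

text \<open>Dividing \<open>f\<close> by the invariant density multiplies it by a Lipschitz
  function, so the quotient is again Lipschitz. The constant obtained depends on neither
  \<open>x\<close> nor \<open>n\<close>.\<close>

lemma gauss_kuzmin_lipschitz_density:
  assumes lip: "L-lipschitz_on {0..\<theta>} f"
  obtains C where "0 \<le> C" and "\<And>x n. x \<in> {0..\<theta>} \<Longrightarrow>
    \<bar>(LINT y:{0..\<theta>}|lebesgue. f y * indicator {..<x} ((theta_map \<theta> ^^ n) y))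
      - (LINT y:{0..\<theta>}|lebesgue. f y) / ln (1 + \<theta>\<^sup>2) * ln ((real m * \<theta> + x) * \<theta>)\<bar>
    \<le> C * (5/6) ^ n * ln ((real m * \<theta> + x) * \<theta>)"
proof -
  define \<phi> where "\<phi> y = f y * (real m * \<theta> + y)" for y
  have "1-lipschitz_on {0..\<theta>} (\<lambda>y. real m * \<theta> + y)"
    by (rule lipschitz_onI) (auto simp: dist_real_def)
  from lipschitz_on_mult_bounded[OF lip this, of "\<bar>f 0\<bar> + L * \<theta>" "real m * \<theta> + \<theta>"]
  obtain K where K: "K-lipschitz_on {0..\<theta>} \<phi>"
    unfolding \<phi>_def using lipschitz_bounded[OF lip] lipschitz_on_nonneg[OF lip] theta_pos by auto
  have eq: "\<phi> y * invariant_density y = f y" if "y \<in> {0..\<theta>}" for y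
    using invariant_density_recip[of y f] that by (simp add: \<phi>_def)
  have 1: "(LINT y:{0..\<theta>}|lebesgue. \<phi> y * invariant_density y * indicator {..<x} ((theta_map \<theta> ^^ n) y)) =
      (LINT y:{0..\<theta>}|lebesgue. f y * indicator {..<x} ((theta_map \<theta> ^^ n) y))" for x n
    using eq by (intro set_lebesgue_integral_cong) auto
  have 2: "mean \<phi> = (LINT y:{0..\<theta>}|lebesgue. f y) / ln (1 + \<theta>\<^sup>2)"
    unfolding mean_def using eq by (intro arg_cong2[where f="(/)"] set_lebesgue_integral_cong) auto
  show thesis
  proof (rule that[of "\<theta> * K"])
    show "0 \<le> \<theta> * K" using theta_pos lipschitz_on_nonneg[OF K] by simp
    fix x n assume "x \<in> {0..\<theta>}"
    from gauss_kuzmin_lipschitz[OF K this, of n]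
    show "\<bar>(LINT y:{0..\<theta>}|lebesgue. f y * indicator {..<x} ((theta_map \<theta> ^^ n) y))
        - (LINT y:{0..\<theta>}|lebesgue. f y) / ln (1 + \<theta>\<^sup>2) * ln ((real m * \<theta> + x) * \<theta>)\<bar>
      \<le> \<theta> * K * (5/6) ^ n * ln ((real m * \<theta> + x) * \<theta>)"
      unfolding 1 2 by (simp only: mult.commute[of K] mult.assoc)
  qed
qed

lemma ln_gauss_le:
  assumes "x \<in> {0..\<theta>}"
  shows "ln ((real m * \<theta> + x) * \<theta>) \<le> ln (1 + \<theta>\<^sup>2)"
proof -
  have "0 < (real m * \<theta> + x) * \<theta>"
    using denom_pos[of x 0] assms theta_pos by (simp add: denom_def)
  then show ?thesis
    unfolding ln_one_plus_theta_square using assms theta_pos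
    by (intro ln_mono mult_right_mono) auto
qed

text \<open>Replace \<open>h\<close> by a Lipschitz function \<open>p\<close> close to it in
  \<open>L1\<close>. The error splits into three parts below \<open>r/3\<close>: the exchange of
  \<open>h\<close> for \<open>p\<close>, uniformly in \<open>n\<close>; the geometric error for
  \<open>p\<close>; and the defect of the integral of \<open>p\<close> from 1.\<close>

lemma gauss_kuzmin_integrable_density:
  assumes h: "set_integrable lebesgue {0..\<theta>} h" and total: "(LINT y:{0..\<theta>}|lebesgue. h y) = 1"
    and x: "x \<in> {0..\<theta>}"
  shows "(\<lambda>n. LINT y:{0..\<theta>}|lebesgue. h y * indicator {..<x} ((theta_map \<theta> ^^ n) y))
    \<longlonglongrightarrow> 1 / ln (1 + \<theta>\<^sup>2) * ln ((real m * \<theta> + x) * \<theta>)"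
proof (rule LIMSEQ_I)
  fix r :: real assume "0 < r"
  define G where "G = ln ((real m * \<theta> + x) * \<theta>)"
  define W where "W = ln (1 + \<theta>\<^sup>2)"
  define I where "I g n = (LINT y:{0..\<theta>}|lebesgue. g y * indicator {..<x} ((theta_map \<theta> ^^ n) y))" for g :: "real \<Rightarrow> real" and n
  have W: "0 < W" and G: "0 \<le> G" "G \<le> W"
    unfolding W_def G_def using ln_one_plus_theta_square_pos ln_gauss_nonneg ln_gauss_le[OF x] x by auto
  have r3: "0 < r/3" using \<open>0 < r\<close> by simp
  obtain L p where p: "L-lipschitz_on {0..\<theta>} p" and hp: "(LINT y:{0..\<theta>}|lebesgue. \<bar>h y - p y\<bar>) < r/3"
    by (rule lipschitz_L1_approximation[OF h r3])
  obtain C where C: "\<And>n. \<bar>I p n - (LINT y:{0..\<theta>}|lebesgue. p y) / W * G\<bar> \<le> C * (5/6) ^ n * G"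
    unfolding I_def G_def W_def by (rule gauss_kuzmin_lipschitz_density[OF p]) (use x in blast)
  have p_int: "set_integrable lebesgue {0..\<theta>} p"
    by (intro absolutely_integrable_continuous_real lipschitz_on_continuous_on[OF p])
  have d_int: "set_integrable lebesgue {0..\<theta>} (\<lambda>y. h y - p y)"
    by (intro set_integral_diff h p_int)
  have ind: "set_integrable lebesgue {0..\<theta>} (\<lambda>y. g y * indicator {..<x} ((theta_map \<theta> ^^ n) y))"
    if "set_integrable lebesgue {0..\<theta>} g" for g :: "real \<Rightarrow> real" and n
  proof -
    have "(\<lambda>y. indicator {..<x} ((theta_map \<theta> ^^ n) y) :: real) \<in> borel_measurable lebesgue"
      by (intro measurable_completion) measurable
    then have "integrable lebesgue (\<lambda>y. indicator {0..\<theta>} y *\<^sub>R g y * indicator {..<x} ((theta_map \<theta> ^^ n) y))"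
      using that unfolding set_integrable_def
      by (intro Bochner_Integration.integrable_bound[OF that[unfolded set_integrable_def]] borel_measurable_times)
        (auto simp: indicator_def)
    then show ?thesis by (simp add: set_integrable_def mult.assoc)
  qed
  have "\<bar>(LINT y:{0..\<theta>}|lebesgue. h y) - (LINT y:{0..\<theta>}|lebesgue. p y)\<bar> \<le> (LINT y:{0..\<theta>}|lebesgue. \<bar>h y - p y\<bar>)"
    using set_integral_norm_bound[OF d_int] by (simp add: set_integral_diff(2)[OF h p_int])
  then have mass: "\<bar>(LINT y:{0..\<theta>}|lebesgue. p y) - 1\<bar> < r/3" using hp total by linarith
  have close: "\<bar>I h n - I p n\<bar> < r/3" for n
  proof -
    have "I h n - I p n = (LINT y:{0..\<theta>}|lebesgue. (h y - p y) * indicator {..<x} ((theta_map \<theta> ^^ n) y))"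
      unfolding I_def left_diff_distrib by (rule set_integral_diff(2)[OF ind[OF h] ind[OF p_int], symmetric])
    also have "\<bar>\<dots>\<bar> \<le> (LINT y:{0..\<theta>}|lebesgue. \<bar>(h y - p y) * indicator {..<x} ((theta_map \<theta> ^^ n) y)\<bar>)"
      using set_integral_norm_bound[OF ind[OF d_int]] by simp
    also have "\<dots> \<le> (LINT y:{0..\<theta>}|lebesgue. \<bar>h y - p y\<bar>)"
      by (rule set_integral_mono[OF set_integrable_abs[OF ind[OF d_int]] set_integrable_abs[OF d_int]])
        (auto simp: indicator_def)
    finally show ?thesis using hp by linarith
  qed
  \<comment> \<open>The approximant is not normalised; the defect of its mass is scaled by
    \<open>G / W\<close>, which lies between 0 and 1.\<close>
  have "(LINT y:{0..\<theta>}|lebesgue. p y) / W * G - 1 / W * G = ((LINT y:{0..\<theta>}|lebesgue. p y) - 1) * (G / W)"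
    by (simp add: diff_divide_distrib left_diff_distrib)
  then have "\<bar>(LINT y:{0..\<theta>}|lebesgue. p y) / W * G - 1 / W * G\<bar> = \<bar>(LINT y:{0..\<theta>}|lebesgue. p y) - 1\<bar> * (G / W)"
    using W G by (simp only: abs_mult) simp
  also have "\<dots> \<le> \<bar>(LINT y:{0..\<theta>}|lebesgue. p y) - 1\<bar> * 1"
    using W G by (intro mult_left_mono) auto
  finally have mean: "\<bar>(LINT y:{0..\<theta>}|lebesgue. p y) / W * G - 1 / W * G\<bar> < r/3"
    using mass by simp
  have "(\<lambda>n. C * (5/6) ^ n * G) \<longlonglongrightarrow> C * 0 * G"
    by (intro tendsto_intros LIMSEQ_power_zero) simp
  then have "eventually (\<lambda>n. C * (5/6) ^ n * G < r/3) sequentially"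
    using \<open>0 < r\<close> by (intro order_tendstoD(2)) auto
  then obtain N where N: "\<And>n. n \<ge> N \<Longrightarrow> C * (5/6) ^ n * G < r/3"
    by (auto simp: eventually_sequentially)
  have "\<bar>I h n - 1 / W * G\<bar> < r" if "n \<ge> N" for n
    using N[OF that] C[of n] close[of n] mean by linarith
  then show "\<exists>no. \<forall>n\<ge>no. norm ((LINT y:{0..\<theta>}|lebesgue. h y * indicator {..<x} ((theta_map \<theta> ^^ n) y))
      - 1 / ln (1 + \<theta>\<^sup>2) * ln ((real m * \<theta> + x) * \<theta>)) < r"
    unfolding I_def W_def G_def by auto
qed

section \<open>From the measure to its density\<close>

lemma density_integral:
  assumes "prob_space \<mu>" and sets: "sets \<mu> = sets (restrict_space borel {0..\<theta>})"
    and dens: "lebesgue_density \<mu> h"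
  shows "set_integrable lebesgue {0..\<theta>} h" and "(LINT y:{0..\<theta>}|lebesgue. h y) = 1"
    and "iterate_dist \<theta> \<mu> n x =
      (LINT y:{0..\<theta>}|lebesgue. h y * indicator {..<x} ((theta_map \<theta> ^^ n) y))"
proof -
  interpret prob_space \<mu> by fact
  have space: "space \<mu> = {0..\<theta>}"
    using sets_eq_imp_space_eq[OF sets] by (simp add: space_restrict_space)
  have h0: "\<And>y. y \<in> {0..\<theta>} \<Longrightarrow> 0 \<le> h y"
    and em: "\<And>A. A \<in> sets \<mu> \<Longrightarrow> emeasure \<mu> A = (\<integral>\<^sup>+ y\<in>A. ennreal (h y) \<partial>lebesgue)"
    and hm: "h \<in> borel_measurable (lebesgue_on {0..\<theta>})"
    using dens by (auto simp: lebesgue_density_def space)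
  have meas: "(\<lambda>y. indicator {0..\<theta>} y * h y) \<in> borel_measurable lebesgue"
    using hm by (subst (asm) borel_measurable_restrict_space_iff) auto
  \<comment> \<open>The nonnegative integral of \<open>h\<close> is the total mass 1; its finiteness
    is what makes \<open>h\<close> integrable.\<close>
  have "(\<integral>\<^sup>+ y. ennreal (indicator {0..\<theta>} y * h y) \<partial>lebesgue) = emeasure \<mu> (space \<mu>)"
    unfolding em[OF sets.top] by (intro nn_integral_cong) (auto simp: space indicator_def)
  also have "\<dots> = 1" by (rule emeasure_space_1)
  finally have "(\<integral>\<^sup>+ y. ennreal (indicator {0..\<theta>} y * h y) \<partial>lebesgue) = 1" .
  then have int: "integrable lebesgue (\<lambda>y. indicator {0..\<theta>} y * h y)"
    using h0 by (intro integrableI_nonneg meas) (auto simp: indicator_def)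
  then show "set_integrable lebesgue {0..\<theta>} h" by (simp add: set_integrable_def)
  \<comment> \<open>Stated for a general Borel predicate because it is used twice: with
    \<open>True\<close> for the total mass and with the event that the iterate lies below
    \<open>x\<close>.\<close>
  have set_formula: "measure \<mu> {y \<in> {0..\<theta>}. P y} = (LINT y:{0..\<theta>}|lebesgue. h y * of_bool (P y))"
    if P: "Measurable.pred borel P" for P
  proof -
    have A: "{y \<in> {0..\<theta>}. P y} \<in> sets \<mu>"
      unfolding sets by (subst sets_restrict_space_iff) (use P in auto)
    have "(\<lambda>y. of_bool (P y) :: real) \<in> borel_measurable lebesgue"
      using P by (intro measurable_completion) measurable
    then have "integrable lebesgue (\<lambda>y. indicator {0..\<theta>} y * h y * of_bool (P y))"
      by (intro Bochner_Integration.integrable_bound[OF int] borel_measurable_times meas) auto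
    then have "(\<integral>\<^sup>+ y. ennreal (indicator {0..\<theta>} y * h y * of_bool (P y)) \<partial>lebesgue)
        = ennreal (LINT y|lebesgue. indicator {0..\<theta>} y * h y * of_bool (P y))"
      using h0 by (intro nn_integral_eq_integral) (auto simp: indicator_def)
    moreover have "(\<integral>\<^sup>+ y. ennreal (indicator {0..\<theta>} y * h y * of_bool (P y)) \<partial>lebesgue)
        = emeasure \<mu> {y \<in> {0..\<theta>}. P y}"
      unfolding em[OF A] by (intro nn_integral_cong) (auto simp: indicator_def)
    moreover have "0 \<le> (LINT y|lebesgue. indicator {0..\<theta>} y * h y * of_bool (P y))"
      using h0 by (intro integral_nonneg_AE AE_I2) (auto simp: indicator_def)
    ultimately have "measure \<mu> {y \<in> {0..\<theta>}. P y} = (LINT y|lebesgue. indicator {0..\<theta>} y * h y * of_bool (P y))"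
      by (intro measure_eq_emeasure_eq_ennreal) metis+
    then show ?thesis by (simp add: set_lebesgue_integral_def mult.assoc)
  qed
  have "{y \<in> {0..\<theta>}. True} = space \<mu>" unfolding space by auto
  then show "(LINT y:{0..\<theta>}|lebesgue. h y) = 1"
    using set_formula[of "\<lambda>_. True"] prob_space by simp
  have "Measurable.pred borel (\<lambda>y. (theta_map \<theta> ^^ n) y < x)" by measurable
  from set_formula[OF this]
  show "iterate_dist \<theta> \<mu> n x = (LINT y:{0..\<theta>}|lebesgue. h y * indicator {..<x} ((theta_map \<theta> ^^ n) y))"
    by (simp add: iterate_dist_def indicator_def of_bool_def lessThan_def)
qed

text \<open>A priori \<open>h\<close> is only almost everywhere equal to the derivative \<open>f\<close> of the
  distribution function.\<close>

lemma derivative_is_density: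
  assumes "prob_space \<mu>" and sets: "sets \<mu> = sets (restrict_space borel {0..\<theta>})"
    and dens: "lebesgue_density \<mu> h"
    and der: "\<And>x. x \<in> {0..\<theta>} \<Longrightarrow>
      ((\<lambda>x. measure \<mu> {0..x}) has_real_derivative f x) (at x within {0..\<theta>})"
    and cont: "continuous_on {0..\<theta>} f"
  shows "lebesgue_density \<mu> f"
proof -
  interpret prob_space \<mu> by fact
  have space: "space \<mu> = {0..\<theta>}"
    using sets_eq_imp_space_eq[OF sets] by (simp add: space_restrict_space)
  have em: "\<And>A. A \<in> sets \<mu> \<Longrightarrow> emeasure \<mu> A = (\<integral>\<^sup>+ y\<in>A. ennreal (h y) \<partial>lebesgue)"
    using dens by (auto simp: lebesgue_density_def)
  have sets_iff: "A \<in> sets \<mu> \<longleftrightarrow> A \<in> sets borel \<and> A \<subseteq> {0..\<theta>}" for A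
    unfolding sets by (subst sets_restrict_space_iff) auto
  define F where "F x = measure \<mu> {0..x}" for x
  \<comment> \<open>A singleton is Lebesgue null, so a measure with a density has no atom at 0.
    Hence the fundamental theorem of calculus returns \<open>F x\<close> itself.\<close>
  have F0: "F 0 = 0"
  proof -
    have "AE y in lebesgue. (y::real) \<notin> {0}"
      using AE_not_in[of "{0::real}" lebesgue] by (simp add: negligible_iff_null_sets[symmetric])
    then have "(\<integral>\<^sup>+ y\<in>{0}. ennreal (h y) \<partial>lebesgue) = (\<integral>\<^sup>+ y. 0 \<partial>(lebesgue :: real measure))"
      by (intro nn_integral_cong_AE) (auto elim!: eventually_mono)
    then have "emeasure \<mu> {0} = 0" using em[of "{0}"] theta_pos by (simp add: sets_iff)
    then show ?thesis by (simp add: F_def measure_def)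
  qed
  have F_mono: "F x \<le> F y" if "x \<le> y" "y \<in> {0..\<theta>}" for x y
    unfolding F_def using that by (intro finite_measure_mono) (auto simp: sets_iff)
  have f_nonneg: "0 \<le> f x" if "x \<in> {0..\<theta>}" for x
  proof (rule tendsto_lowerbound)
    show "((\<lambda>y. (F y - F x) / (y - x)) \<longlongrightarrow> f x) (at x within {0..\<theta>})"
      using der[OF that] by (simp add: has_field_derivative_iff F_def)
    show "\<forall>\<^sub>F y in at x within {0..\<theta>}. 0 \<le> (F y - F x) / (y - x)"
      unfolding eventually_at_filter
    proof (intro always_eventually allI impI)
      fix y assume "y \<in> {0..\<theta>}"
      then show "0 \<le> (F y - F x) / (y - x)"
        using F_mono[of x y] F_mono[of y x] that
        by (cases x y rule: linorder_cases) (auto intro: divide_nonneg_nonneg divide_nonpos_nonpos)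
    qed
    show "at x within {0..\<theta>} \<noteq> bot"
      using that theta_pos by (auto simp: trivial_limit_within islimpt_Icc)
  qed
  have f_int: "(f has_integral F x) {0..x}" if "x \<in> {0..\<theta>}" for x
  proof -
    have "(f has_integral (F x - F 0)) {0..x}"
    proof (rule fundamental_theorem_of_calculus)
      fix t assume "t \<in> {0..x}"
      then show "(F has_vector_derivative f t) (at t within {0..x})"
        using der[of t] that unfolding has_real_derivative_iff_has_vector_derivative[symmetric] F_def
        by (auto intro: DERIV_subset)
    qed (use that in simp)
    then show ?thesis by (simp add: F0)
  qed
  \<comment> \<open>Extending \<open>f\<close> by zero allows a comparison of two finite Borel
    measures on the whole line, which are determined by their distribution functions.\<close>
  define k where "k x = indicator {0..\<theta>} x * f x" for x
  have k_meas [measurable]: "k \<in> borel_measurable borel"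
    using borel_measurable_continuous_on_indicator[OF _ cont] by (simp add: k_def[abs_def])
  have k_nonneg: "0 \<le> k x" for x using f_nonneg by (auto simp: k_def indicator_def)
  define N where "N = density lborel (\<lambda>x. ennreal (k x))"
  define M where "M = distr \<mu> borel (\<lambda>x. x)"
  have id_meas: "(\<lambda>x. x) \<in> borel_measurable \<mu>"
    unfolding measurable_cong_sets[OF sets refl] by (rule measurable_restrict_space1) simp
  have M_em: "emeasure M A = emeasure \<mu> (A \<inter> {0..\<theta>})" if "A \<in> sets borel" for A
    unfolding M_def using emeasure_distr[OF id_meas that] by (simp add: space)
  \<comment> \<open>No mass lies beyond \<open>\<theta>\<close>, hence
    \<open>min x \<theta>\<close>. For negative \<open>x\<close> the interval \<open>{0..x}\<close>
    is empty and both sides are 0.\<close>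
  have N_em: "emeasure N {..x} = ennreal (F (min x \<theta>))" for x
  proof (cases "0 \<le> x")
    case True
    then have x: "min x \<theta> \<in> {0..\<theta>}" using theta_pos by auto
    have "emeasure N {..x} = (\<integral>\<^sup>+ y. ennreal (k y) * indicator {..x} y \<partial>lborel)"
      unfolding N_def by (subst emeasure_density) auto
    also have "\<dots> = (\<integral>\<^sup>+ y. ennreal (f y) * indicator {0..min x \<theta>} y \<partial>lborel)"
      by (intro nn_integral_cong) (auto simp: k_def indicator_def)
    also have "\<dots> = (\<integral>\<^sup>+ y. ennreal (k y) * indicator {0..min x \<theta>} y \<partial>lborel)"
      by (intro nn_integral_cong) (auto simp: k_def indicator_def)
    also have "\<dots> = ennreal (F (min x \<theta>))"
    proof (rule nn_integral_has_integral_lebesgue')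
      show "(k has_integral F (min x \<theta>)) {0..min x \<theta>}"
        by (rule has_integral_eq[OF _ f_int[OF x]]) (use x in \<open>auto simp: k_def\<close>)
    qed (use k_nonneg in auto)
    finally show ?thesis .
  next
    case False
    have "emeasure N {..x} = (\<integral>\<^sup>+ y. ennreal (k y) * indicator {..x} y \<partial>lborel)"
      unfolding N_def by (subst emeasure_density) auto
    also have "\<dots> = (\<integral>\<^sup>+ y. 0 \<partial>(lborel :: real measure))"
      using False by (intro nn_integral_cong) (auto simp: k_def indicator_def)
    finally show ?thesis using False theta_pos by (simp add: F_def)
  qed
  have M_em_F: "emeasure M {..x} = ennreal (F (min x \<theta>))" for x
  proof -
    have "{..x} \<inter> {0..\<theta>} = {0..min x \<theta>}" by auto
    then show ?thesis by (simp add: M_em F_def emeasure_eq_measure)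
  qed
  have N_space: "emeasure N (space N) = 1"
  proof -
    have "emeasure N UNIV = (\<integral>\<^sup>+ y. ennreal (k y) * indicator UNIV y \<partial>lborel)"
      unfolding N_def by (subst emeasure_density) auto
    also have "\<dots> = (\<integral>\<^sup>+ y. ennreal (k y) * indicator {..\<theta>} y \<partial>lborel)"
      by (intro nn_integral_cong) (auto simp: k_def indicator_def)
    also have "\<dots> = emeasure N {..\<theta>}"
      unfolding N_def by (subst emeasure_density) auto
    also have "\<dots> = 1"
      using prob_space unfolding N_em by (simp add: F_def space)
    finally show ?thesis by (simp add: N_def)
  qed
  have "M = N"
  proof (rule cdf_unique')
    show "finite_borel_measure M"
      unfolding finite_borel_measure_def finite_borel_measure_axioms_def M_def
      by (auto intro!: finite_measure_distr id_meas)
    have "finite_measure N" by (rule finite_measureI) (simp add: N_space)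
    moreover have "sets N = sets borel" by (simp add: N_def)
    ultimately show "finite_borel_measure N"
      by (simp add: finite_borel_measure_def finite_borel_measure_axioms_def)
    show "cdf M = cdf N" by (simp add: fun_eq_iff cdf_def measure_def N_em M_em_F)
  qed
  show ?thesis
    unfolding lebesgue_density_def space
  proof (intro conjI ballI)
    show "f \<in> borel_measurable (lebesgue_on {0..\<theta>})"
      by (intro continuous_imp_measurable_on_sets_lebesgue cont) simp
    show "0 \<le> f x" if "x \<in> {0..\<theta>}" for x by (rule f_nonneg[OF that])
    fix A assume "A \<in> sets \<mu>"
    then have A: "A \<in> sets borel" "A \<subseteq> {0..\<theta>}" by (auto simp: sets_iff)
    have "emeasure \<mu> A = emeasure N A"
      using M_em[OF A(1)] A(2) \<open>M = N\<close> by (simp add: Int_absorb2)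
    also have "\<dots> = (\<integral>\<^sup>+ y. ennreal (k y) * indicator A y \<partial>lborel)"
      unfolding N_def using A by (subst emeasure_density) auto
    also have "\<dots> = (\<integral>\<^sup>+ y. ennreal (k y) * indicator A y \<partial>lebesgue)"
      using A by (subst nn_integral_completion) auto
    also have "\<dots> = (\<integral>\<^sup>+ y\<in>A. ennreal (f y) \<partial>lebesgue)"
      using A by (intro nn_integral_cong) (auto simp: k_def indicator_def)
    finally show "emeasure \<mu> A = (\<integral>\<^sup>+ y\<in>A. ennreal (f y) \<partial>lebesgue)" .
  qed
qed

end

section \<open>The limit law and its geometric error term\<close>

theorem theorem6p1:
  fixes \<theta> :: real and m :: nat and \<mu> :: "real measure" and h :: "real \<Rightarrow> real"
  assumes "0 < \<theta>" and "\<theta> < 1" and "1 \<le> m" and "\<theta>\<^sup>2 = 1 / real m"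
    and "prob_space \<mu>"
    and "sets \<mu> = sets (restrict_space borel {0..\<theta>})"
    and "nonatomic \<mu>"
    and "lebesgue_density \<mu> h"
    and "riemann_integrable h 0 \<theta>"
  shows
    "(\<forall>x\<in>{0..\<theta>}.
        (\<lambda>n. iterate_dist \<theta> \<mu> n x)
          \<longlonglongrightarrow> 1 / ln (1 + \<theta>\<^sup>2) * ln ((real m * \<theta> + x) * \<theta>)) \<and>
     (lipschitz_derivative_on {0..\<theta>} (\<lambda>x. measure \<mu> {0..x}) \<longrightarrow>
        (\<exists>q K :: real. 0 < q \<and> q < 1 \<and> 0 < K \<and>
          (\<exists>\<alpha> :: nat \<Rightarrow> real \<Rightarrow> real. \<forall>x\<in>{0..\<theta>}. \<forall>n\<ge>1.
             \<bar>\<alpha> n x\<bar> \<le> K \<and>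
             iterate_dist \<theta> \<mu> n x
               = (1 + \<alpha> n x * q ^ n) / ln (1 + \<theta>\<^sup>2) * ln ((real m * \<theta> + x) * \<theta>) \<and>
             error_term \<theta> m \<mu> n x
               = \<alpha> n x * q ^ n / ln (1 + \<theta>\<^sup>2) * ln ((real m * \<theta> + x) * \<theta>))))"
proof (intro conjI ballI impI)
  interpret theta_expansion \<theta> m
    by unfold_locales (use assms in auto)
  fix x assume x: "x \<in> {0..\<theta>}"
  show "(\<lambda>n. iterate_dist \<theta> \<mu> n x) \<longlonglongrightarrow> 1 / ln (1 + \<theta>\<^sup>2) * ln ((real m * \<theta> + x) * \<theta>)"
    unfolding density_integral(3)[OF assms(5,6,8)]
    by (rule gauss_kuzmin_integrable_density[OF density_integral(1,2)[OF assms(5,6,8)] x])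
next
  interpret theta_expansion \<theta> m
    by unfold_locales (use assms in auto)
  assume "lipschitz_derivative_on {0..\<theta>} (\<lambda>x. measure \<mu> {0..x})"
  then obtain f L where der: "\<And>x. x \<in> {0..\<theta>} \<Longrightarrow>
      ((\<lambda>x. measure \<mu> {0..x}) has_real_derivative f x) (at x within {0..\<theta>})"
    and lip: "L-lipschitz_on {0..\<theta>} f"
    unfolding lipschitz_derivative_on_def by blast
  \<comment> \<open>The Lipschitz condition concerns the derivative \<open>f\<close>, so from here
    on \<open>f\<close> takes the place of \<open>h\<close> as density.\<close>
  have f: "lebesgue_density \<mu> f"
    by (rule derivative_is_density[OF assms(5,6,8) der lipschitz_on_continuous_on[OF lip]])
  define W where "W = ln (1 + \<theta>\<^sup>2)"
  define G where "G x = ln ((real m * \<theta> + x) * \<theta>)" for x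
  have W: "0 < W" unfolding W_def by (rule ln_one_plus_theta_square_pos)
  obtain C where C: "0 \<le> C"
    and bound: "\<And>x n. x \<in> {0..\<theta>} \<Longrightarrow> \<bar>iterate_dist \<theta> \<mu> n x - 1 / W * G x\<bar> \<le> C * (5/6) ^ n * G x"
    using gauss_kuzmin_lipschitz_density[OF lip]
    unfolding density_integral(2,3)[OF assms(5,6) f] W_def G_def by blast
  \<comment> \<open>The required identity solved for \<open>\<alpha>\<close>. On
    \<open>{0..\<theta>}\<close>, \<open>G x\<close> vanishes only at \<open>x = 0\<close>; there
    \<open>bound\<close> forces the error to vanish too, so the default 0 satisfies the
    identity.\<close>
  define \<alpha> where "\<alpha> n x = (if G x = 0 then 0 else (iterate_dist \<theta> \<mu> n x - 1 / W * G x) * W / (G x * (5/6) ^ n))"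
    for n x
  \<comment> \<open>The summand 1 makes the constant strictly positive even if \<open>C\<close> is
    0. The factor \<open>G x\<close> in \<open>bound\<close> cancels the one in the denominator of
    \<open>\<alpha>\<close>.\<close>
  have \<alpha>_bound: "\<bar>\<alpha> n x\<bar> \<le> C * W + 1" if "x \<in> {0..\<theta>}" for n x
  proof (cases "G x = 0")
    case False
    then have G: "0 < G x" using ln_gauss_nonneg[of x] that by (simp add: G_def)
    have "\<bar>\<alpha> n x\<bar> = \<bar>iterate_dist \<theta> \<mu> n x - 1 / W * G x\<bar> * W / (G x * (5/6) ^ n)"
      using G W by (simp add: \<alpha>_def abs_mult)
    also have "\<dots> \<le> C * (5/6) ^ n * G x * W / (G x * (5/6) ^ n)"
      using G W bound[OF that] by (intro divide_right_mono mult_right_mono) auto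
    also have "\<dots> = C * W" using G by simp
    finally show ?thesis by simp
  qed (use C W in \<open>simp add: \<alpha>_def\<close>)
  have error: "iterate_dist \<theta> \<mu> n x - 1 / W * G x = \<alpha> n x * (5/6) ^ n / W * G x" if "x \<in> {0..\<theta>}" for n x
  proof (cases "G x = 0")
    case True
    then show ?thesis using bound[OF that, of n] by simp
  next
    case False
    then show ?thesis using W by (simp add: \<alpha>_def)
  qed
  have dist: "iterate_dist \<theta> \<mu> n x = (1 + \<alpha> n x * (5/6) ^ n) / W * G x" if "x \<in> {0..\<theta>}" for n x
    using error[OF that, of n] by (simp add: add_divide_distrib distrib_right)
  have K_pos: "0 < C * W + 1" using C W by (simp add: add_nonneg_pos)
  have "\<bar>\<alpha> n x\<bar> \<le> C * W + 1 \<and>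
      iterate_dist \<theta> \<mu> n x
        = (1 + \<alpha> n x * (5/6) ^ n) / ln (1 + \<theta>\<^sup>2) * ln ((real m * \<theta> + x) * \<theta>) \<and>
      error_term \<theta> m \<mu> n x
        = \<alpha> n x * (5/6) ^ n / ln (1 + \<theta>\<^sup>2) * ln ((real m * \<theta> + x) * \<theta>)"
    if "x \<in> {0..\<theta>}" for n x
    using \<alpha>_bound[OF that] dist[OF that] error[OF that] unfolding error_term_def W_def G_def by blast
  moreover have "(0::real) < 5/6" "(5/6::real) < 1" by simp_all
  ultimately show "\<exists>q K :: real. 0 < q \<and> q < 1 \<and> 0 < K \<and>
      (\<exists>\<alpha> :: nat \<Rightarrow> real \<Rightarrow> real. \<forall>x\<in>{0..\<theta>}. \<forall>n\<ge>1.
         \<bar>\<alpha> n x\<bar> \<le> K \<and>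
         iterate_dist \<theta> \<mu> n x
           = (1 + \<alpha> n x * q ^ n) / ln (1 + \<theta>\<^sup>2) * ln ((real m * \<theta> + x) * \<theta>) \<and>
         error_term \<theta> m \<mu> n x
           = \<alpha> n x * q ^ n / ln (1 + \<theta>\<^sup>2) * ln ((real m * \<theta> + x) * \<theta>))"
    using K_pos by blast
qed

end
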